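(* Let $L>0$. For any nice function $A\in\mathcal A_*$ on $[0,L]$ and any partition $\mathcal P=\{0<t_1<\cdots<t_{n-1}<L\}$ of $[0,L]$ that contains the set of discontinuities of $A$, we have the equality of unbounded operators $$L_{A,\mathcal P}=\mathcal I_{\mathcal P}\,T_A\,\mathcal I_{\mathcal P}^{-1}.$$
   Context: $\boldsymbol H=L^2([0,L],\mathbb C)$. A function $A:[0,L]\to\mathbb R$ is admissible ($A\in\mathcal A$) if it has bounded variation, is right continuous and $A(0)=0$. *The operator $T_A$.* For $A\in\mathcal A$ let $\Phi_A(t)=iA(t)-t$ and let $R_A$ be the bounded (compact, injective) operator on $\boldsymbol H$ $$(R_Af)(t)=\frac{i\,e^{-\Phi_A(t)}}{e^{\Phi_A(L)}-1}\int_0^Le^{\Phi_A(s)}f(s)\,ds+i\int_0^te^{-(\Phi_A(t)-\Phi_A(s))}f(s)\,ds .$$ Then $T_A:=R_A^{-1}-i$, a closed densely defined operator on $\boldsymbol H$ with domain $\mathrm{Range}(R_A)$. *Nice functions.* Let $H(t)=1$ for $t\ge0$ and $H(t)=0$ for $t<0$. $A\in\mathcal A$ is nice ($A\in\mathcal A_*$) if there exist a real-valued $a\in L^\infty(0,L)$, a finite set $\mathcal Q\subset(0,L)$ and $c:\mathcal Q\to\mathbb R$ such that, with $A_*(t):=\int_0^ta(s)\,ds$, one has $A(t)=A_*(t)+\sum_{p\in\mathcal Q}c(p)H(t-p)$ for all $t\in[0,L]$. Then $a=dA_*/dt$ a.e. *The operator $L_{A,\mathcal P}$.* Put $t_0=0$,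 $t_n=L$, $I_k=[t_{k-1},t_k]$, $a_k=a|_{I_k}$ for $k=1,\dots,n$, and let $c_j=A(t_j^+)-A(t_j^-)$ be the jump of $A$ at $t_j$, $j=1,\dots,n-1$. Let $\boldsymbol H_{\mathcal P}=\bigoplus_{k=1}^nL^2(I_k,\mathbb C)$ and let $\mathcal I_{\mathcal P}:\boldsymbol H\to\boldsymbol H_{\mathcal P}$, $f\mapsto(f|_{I_1},\dots,f|_{I_n})$. The domain of $L_{A,\mathcal P}$ consists of $(u_1,\dots,u_n)\in\boldsymbol H_{\mathcal P}$ such that $u_k\in L^{1,2}(I_k)$ for all $k$ (the Sobolev space of $L^2$ functions with one weak derivative in $L^2$), $u_{j+1}(t_j)=e^{-ic_j}u_j(t_j)$ for $j=1,\dots,n-1$, and $u_n(L)=u_1(0)$; and $$L_{A,\mathcal P}(u_1,\dots,u_n)=\Bigl(-i\tfrac{du_1}{dt}+a_1u_1,\ \dots,\ -i\tfrac{du_n}{dt}+a_nu_n\Bigr).$$ *)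

theory Defs
  imports "HOL-Analysis.Analysis"
begin

text \<open>
  Elements of L2 are genuine almost-everywhere classes. Representatives are total functions on
  the reals; since the relation only looks at the measure space, their values off the interval
  under consideration are irrelevant.
\<close>

definition l2_fun :: "real measure \<Rightarrow> (real \<Rightarrow> complex) set" where
  "l2_fun M = {f \<in> borel_measurable M. integrable M (\<lambda>x. (norm (f x))\<^sup>2)}"

definition l2_rel :: "real measure \<Rightarrow> ((real \<Rightarrow> complex) \<times> (real \<Rightarrow> complex)) set" where
  "l2_rel M = {(f, g). f \<in> l2_fun M \<and> g \<in> l2_fun M \<and> (AE x in M. f x = g x)}"

definition l2_class :: "real measure \<Rightarrow> (real \<Rightarrow> complex) \<Rightarrow> (real \<Rightarrow> complex) set" where
  "l2_class M f = l2_rel M `` {f}"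

definition L2 :: "real set \<Rightarrow> (real \<Rightarrow> complex) set set" where
  "L2 I = l2_fun (lebesgue_on I) // l2_rel (lebesgue_on I)"

definition l2_add ::
  "real set \<Rightarrow> (real \<Rightarrow> complex) set \<Rightarrow> (real \<Rightarrow> complex) set \<Rightarrow> (real \<Rightarrow> complex) set" where
  "l2_add I F G = (\<Union>f\<in>F. \<Union>g\<in>G. l2_class (lebesgue_on I) (\<lambda>x. f x + g x))"

text \<open>Meaningful for bounded \<open>m\<close>; constant \<open>m\<close> gives scalar multiplication.\<close>

definition l2_mult ::
  "real set \<Rightarrow> (real \<Rightarrow> complex) \<Rightarrow> (real \<Rightarrow> complex) set \<Rightarrow> (real \<Rightarrow> complex) set" where
  "l2_mult I m F = (\<Union>f\<in>F. l2_class (lebesgue_on I) (\<lambda>x. m x * f x))"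

definition l2_restrict :: "real set \<Rightarrow> (real \<Rightarrow> complex) set \<Rightarrow> (real \<Rightarrow> complex) set" where
  "l2_restrict I F = (\<Union>f\<in>F. l2_class (lebesgue_on I) f)"

text \<open>
  An unbounded operator is a partial map: its domain is the operator domain, so that equality of
  partial maps means equality of domains and of values.
\<close>

definition total_op :: "'a set \<Rightarrow> ('a \<Rightarrow> 'b) \<Rightarrow> 'a \<rightharpoonup> 'b" where
  "total_op X f = (\<lambda>x. Some (f x)) |` X"

text \<open>Meaningful for \<open>f\<close> injective on \<open>X\<close>.\<close>

definition inverse_op :: "'a set \<Rightarrow> ('a \<Rightarrow> 'b) \<Rightarrow> 'b \<rightharpoonup> 'a" where
  "inverse_op X f = total_op (f ` X) (the_inv_into X f)"

definition bounded_variation_on :: "real \<Rightarrow> real \<Rightarrow> (real \<Rightarrow> real) \<Rightarrow> bool" where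
  "bounded_variation_on p q f \<longleftrightarrow>
     (\<exists>B. \<forall>(n::nat) s. (\<forall>i\<le>n. s i \<in> {p..q}) \<and> (\<forall>i<n. s i \<le> s (Suc i)) \<longrightarrow>
        (\<Sum>i<n. \<bar>f (s (Suc i)) - f (s i)\<bar>) \<le> B)"

definition admissible :: "real \<Rightarrow> (real \<Rightarrow> real) \<Rightarrow> bool" where
  "admissible L A \<longleftrightarrow>
     bounded_variation_on 0 L A \<and> (\<forall>t\<in>{0..<L}. continuous (at_right t) A) \<and> A 0 = 0"

definition heaviside :: "real \<Rightarrow> real" where
  "heaviside t = (if t \<ge> 0 then 1 else 0)"

definition Linfty_fun :: "real set \<Rightarrow> (real \<Rightarrow> real) \<Rightarrow> bool" where
  "Linfty_fun I a \<longleftrightarrow>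
     a \<in> borel_measurable (lebesgue_on I) \<and> (\<exists>C. AE x in lebesgue_on I. \<bar>a x\<bar> \<le> C)"

text \<open>\<open>a\<close> is a representative of the density of the absolutely continuous part of \<open>A\<close>.\<close>

definition nice_density :: "real \<Rightarrow> (real \<Rightarrow> real) \<Rightarrow> (real \<Rightarrow> real) \<Rightarrow> bool" where
  "nice_density L A a \<longleftrightarrow>
     Linfty_fun {0<..<L} a \<and>
     (\<exists>Q c. finite Q \<and> Q \<subseteq> {0<..<L} \<and>
        (\<forall>t\<in>{0..L}. A t = (LINT s|lebesgue_on {0..t}. a s) + (\<Sum>p\<in>Q. c p * heaviside (t - p))))"

definition nice :: "real \<Rightarrow> (real \<Rightarrow> real) \<Rightarrow> bool" where
  "nice L A \<longleftrightarrow> admissible L A \<and> (\<exists>a. nice_density L A a)"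

definition Phi :: "(real \<Rightarrow> real) \<Rightarrow> real \<Rightarrow> complex" where
  "Phi A t = \<i> * complex_of_real (A t) - complex_of_real t"

definition R_fun :: "real \<Rightarrow> (real \<Rightarrow> real) \<Rightarrow> (real \<Rightarrow> complex) \<Rightarrow> real \<Rightarrow> complex" where
  "R_fun L A f t =
     \<i> * exp (- Phi A t) / (exp (Phi A L) - 1) * (LINT s|lebesgue_on {0..L}. exp (Phi A s) * f s)
     + \<i> * (LINT s|lebesgue_on {0..t}. exp (- (Phi A t - Phi A s)) * f s)"

definition R_op :: "real \<Rightarrow> (real \<Rightarrow> real) \<Rightarrow> (real \<Rightarrow> complex) set \<Rightarrow> (real \<Rightarrow> complex) set" where
  "R_op L A F = (\<Union>f\<in>F. l2_class (lebesgue_on {0..L}) (R_fun L A f))"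

definition T_op :: "real \<Rightarrow> (real \<Rightarrow> real) \<Rightarrow> (real \<Rightarrow> complex) set \<rightharpoonup> (real \<Rightarrow> complex) set" where
  "T_op L A = (\<lambda>U. map_option (\<lambda>F. l2_add {0..L} F (l2_mult {0..L} (\<lambda>_. - \<i>) U))
                 (inverse_op (L2 {0..L}) (R_op L A) U))"

definition test_functions :: "real \<Rightarrow> real \<Rightarrow> (real \<Rightarrow> real) set" where
  "test_functions p q =
     {\<phi>. (\<forall>m x. (deriv ^^ m) \<phi> field_differentiable (at x)) \<and>
         (\<exists>K. compact K \<and> K \<subseteq> {p<..<q} \<and> (\<forall>x. x \<notin> K \<longrightarrow> \<phi> x = 0))}"

definition is_weak_deriv ::
  "real \<Rightarrow> real \<Rightarrow> (real \<Rightarrow> complex) set \<Rightarrow> (real \<Rightarrow> complex) set \<Rightarrow> bool" where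
  "is_weak_deriv p q U V \<longleftrightarrow>
     (\<forall>u\<in>U. \<forall>v\<in>V. \<forall>\<phi>\<in>test_functions p q.
        (LINT x|lebesgue_on {p..q}. u x * complex_of_real (deriv \<phi> x)) =
        - (LINT x|lebesgue_on {p..q}. v x * complex_of_real (\<phi> x)))"

definition sobolev :: "real \<Rightarrow> real \<Rightarrow> (real \<Rightarrow> complex) set set" where
  "sobolev p q = {U \<in> L2 {p..q}. \<exists>V\<in>L2 {p..q}. is_weak_deriv p q U V}"

definition weak_deriv :: "real \<Rightarrow> real \<Rightarrow> (real \<Rightarrow> complex) set \<Rightarrow> (real \<Rightarrow> complex) set" where
  "weak_deriv p q U = (THE V. V \<in> L2 {p..q} \<and> is_weak_deriv p q U V)"

text \<open>Boundary and matching conditions refer to the continuous representative on the closed interval.\<close>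

definition cont_value :: "real \<Rightarrow> real \<Rightarrow> (real \<Rightarrow> complex) set \<Rightarrow> real \<Rightarrow> complex" where
  "cont_value p q U x = (THE z. \<exists>u\<in>U. continuous_on {p..q} u \<and> u x = z)"

text \<open>A partition is given by points \<open>t 0 = 0 < t 1 < \<dots> < t n = L\<close>; other values of \<open>t\<close> are
  irrelevant.\<close>

definition is_partition :: "real \<Rightarrow> nat \<Rightarrow> (nat \<Rightarrow> real) \<Rightarrow> bool" where
  "is_partition L n t \<longleftrightarrow> n \<ge> 1 \<and> t 0 = 0 \<and> t n = L \<and> (\<forall>k<n. t k < t (Suc k))"

definition discontinuities :: "real \<Rightarrow> (real \<Rightarrow> real) \<Rightarrow> real set" where
  "discontinuities L A = {x \<in> {0..L}. \<not> continuous (at x within {0..L}) A}"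

definition jump :: "(real \<Rightarrow> real) \<Rightarrow> real \<Rightarrow> real" where
  "jump A x = Lim (at_right x) A - Lim (at_left x) A"

definition HP :: "nat \<Rightarrow> (nat \<Rightarrow> real) \<Rightarrow> (nat \<Rightarrow> (real \<Rightarrow> complex) set) set" where
  "HP n t = (\<Pi>\<^sub>E k\<in>{1..n}. L2 {t (k - 1)..t k})"

definition IP ::
  "nat \<Rightarrow> (nat \<Rightarrow> real) \<Rightarrow> (real \<Rightarrow> complex) set \<Rightarrow> nat \<Rightarrow> (real \<Rightarrow> complex) set" where
  "IP n t F = (\<lambda>k\<in>{1..n}. l2_restrict {t (k - 1)..t k} F)"

definition L_dom ::
  "nat \<Rightarrow> (nat \<Rightarrow> real) \<Rightarrow> (real \<Rightarrow> real) \<Rightarrow> (nat \<Rightarrow> (real \<Rightarrow> complex) set) set" where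
  "L_dom n t A =
     {U \<in> HP n t.
        (\<forall>k\<in>{1..n}. U k \<in> sobolev (t (k - 1)) (t k)) \<and>
        (\<forall>j\<in>{1..<n}. cont_value (t j) (t (j + 1)) (U (j + 1)) (t j) =
           exp (- \<i> * complex_of_real (jump A (t j))) *
           cont_value (t (j - 1)) (t j) (U j) (t j)) \<and>
        cont_value (t (n - 1)) (t n) (U n) (t n) = cont_value (t 0) (t 1) (U 1) (t 0)}"

definition L_op ::
  "nat \<Rightarrow> (nat \<Rightarrow> real) \<Rightarrow> (real \<Rightarrow> real) \<Rightarrow> (real \<Rightarrow> real) \<Rightarrow>
   (nat \<Rightarrow> (real \<Rightarrow> complex) set) \<rightharpoonup> (nat \<Rightarrow> (real \<Rightarrow> complex) set)" where
  "L_op n t A a = total_op (L_dom n t A)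
     (\<lambda>U. \<lambda>k\<in>{1..n}.
        l2_add {t (k - 1)..t k}
          (l2_mult {t (k - 1)..t k} (\<lambda>_. - \<i>) (weak_deriv (t (k - 1)) (t k) (U k)))
          (l2_mult {t (k - 1)..t k} (\<lambda>x. complex_of_real (a x)) (U k)))"

end

theory Submission
  imports Defs
begin

text \<open>
  Both operators describe the same first-order differential expression, and the resolvent kernel
  is what solving that equation by an integrating factor produces. For \<open>u = R f\<close> the product
  \<open>W = exp \<Phi> * u\<close> is an indefinite integral of \<open>i * exp \<Phi> * f\<close>, and the constant in \<open>R\<close> is
  exactly the one for which \<open>u(L) = u(0)\<close>. On one interval \<open>I\<^sub>k\<close> of the partition \<open>A\<close> agrees, off
  the right end point, with a Lipschitz function, so \<open>u\<close> has there the absolutely continuous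
  representative \<open>exp (- \<Phi>\<^sub>k) * W\<close>. The product rule gives \<open>- i u' + a u = f - i u\<close>, which is
  \<open>T u\<close>; and since \<open>W\<close> is continuous across \<open>t\<^sub>j\<close> while \<open>\<Phi>\<close> jumps by \<open>i c\<^sub>j\<close>, the one-sided values
  of \<open>u\<close> differ by the factor \<open>exp (- i c\<^sub>j)\<close> (\<open>range_R_in_L_dom\<close>).

  Conversely, given \<open>(u\<^sub>k)\<close> in the domain of the piecewise operator, glue the functions
  \<open>f\<^sub>k = - i u\<^sub>k' + (a + i) u\<^sub>k\<close> to one \<open>f\<close>. On each piece \<open>exp \<Phi>\<^sub>k * u\<^sub>k\<close> is a primitive of
  \<open>i * exp \<Phi> * f\<close>, the matching conditions make these primitives fit together to one function on
  \<open>[0, L]\<close>, and the periodicity condition determines its initial value, so that \<open>(u\<^sub>k)\<close> comes from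
  \<open>R f\<close> (\<open>L_dom_subset_range_R\<close>). As \<open>R\<close> and the restriction map are injective, domains and values
  of the two partial maps agree.

  The analytic input is the identification of weakly differentiable functions with indefinite
  integrals (\<open>primitive_integration_by_parts\<close>, \<open>du_Bois_Reymond\<close>), together with the product rule and
  the exponential rule for indefinite integrals (\<open>primitive_mult\<close>, \<open>primitive_exp\<close>).
\<close>

section \<open>Calculus of indefinite integrals\<close>

text \<open>
  The vehicle for all identities between indefinite integrals below: cutting \<open>[p, z]\<close> into \<open>N\<close> equal
  parts bounds the total increment by \<open>C (z - p) (G z - G p) / N\<close>. It replaces differentiation almost
  everywhere, and \<open>G\<close> may be the integral of an unbounded function.
\<close>

lemma eq_if_increments_product_bounded:
  fixes D :: "real \<Rightarrow> 'b::real_normed_vector" and G :: "real \<Rightarrow> real"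
  assumes bound: "\<And>x y. p \<le> x \<Longrightarrow> x \<le> y \<Longrightarrow> y \<le> q \<Longrightarrow>
      norm (D y - D x) \<le> C * (y - x) * (G y - G x)"
    and z: "p \<le> z" "z \<le> q"
  shows "D z = D p"
proof -
  have le: "norm (D z - D p) \<le> (C * (z - p) * (G z - G p)) * (1 / real (Suc N))" for N
  proof -
    define d where "d = (z - p) / real (Suc N)"
    define s where "s i = p + real i * d" for i
    have d: "d \<ge> 0" "real (Suc N) * d = z - p"
      using z by (auto simp: d_def)
    have s_end: "s (Suc N) = z" "s 0 = p"
      using d by (auto simp: s_def)
    have s_mono: "s i \<le> s j" if "i \<le> j" for i j
      using that d by (auto simp: s_def intro!: mult_right_mono)
    have "D z - D p = (\<Sum>i<Suc N. D (s (Suc i)) - D (s i))"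
      using sum_lessThan_telescope[of "\<lambda>i. D (s i)" "Suc N"] s_end by simp
    also have "norm \<dots> \<le> (\<Sum>i<Suc N. C * d * (G (s (Suc i)) - G (s i)))"
    proof (rule sum_norm_le)
      fix i assume i: "i \<in> {..<Suc N}"
      have "norm (D (s (Suc i)) - D (s i)) \<le> C * (s (Suc i) - s i) * (G (s (Suc i)) - G (s i))"
        using s_mono[of 0 i] s_mono[of i "Suc i"] s_mono[of "Suc i" "Suc N"] i s_end z
        by (intro bound) auto
      also have "s (Suc i) - s i = d"
        by (simp add: s_def algebra_simps)
      finally show "norm (D (s (Suc i)) - D (s i)) \<le> C * d * (G (s (Suc i)) - G (s i))" .
    qed
    also have "\<dots> = C * d * (G z - G p)"
      using sum_lessThan_telescope[of "\<lambda>i. G (s i)" "Suc N"] s_end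
      by (simp only: sum_distrib_left [symmetric])
    finally show ?thesis
      by (simp add: d_def)
  qed
  have "(\<lambda>N. (C * (z - p) * (G z - G p)) * (1 / real (Suc N))) \<longlonglongrightarrow> (C * (z - p) * (G z - G p)) * 0"
    by (intro tendsto_mult_left LIMSEQ_Suc lim_1_over_n)
  then have "norm (D z - D p) \<le> 0"
    using le by (intro LIMSEQ_le_const[of _ 0 "norm (D z - D p)"]) auto
  then show ?thesis by simp
qed

lemma integral_Icc_diff:
  fixes f :: "real \<Rightarrow> 'b::banach"
  assumes "f integrable_on {p..q}" "p \<le> x" "x \<le> y" "y \<le> q"
  shows "integral {p..y} f - integral {p..x} f = integral {x..y} f"
proof -
  have "f integrable_on {p..y}"
    by (rule integrable_on_subinterval[OF assms(1)]) (use assms in auto)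
  then have "integral {p..x} f + integral {x..y} f = integral {p..y} f"
    by (rule Henstock_Kurzweil_Integration.integral_combine[OF assms(2,3)])
  then show ?thesis by (simp add: algebra_simps)
qed

text \<open>
  Absolute continuity on \<open>[p, q]\<close> with a chosen representative \<open>v\<close> of the derivative.
\<close>

definition primitive :: "real \<Rightarrow> real \<Rightarrow> (real \<Rightarrow> complex) \<Rightarrow> (real \<Rightarrow> complex) \<Rightarrow> bool" where
  "primitive p q v u \<longleftrightarrow>
     v absolutely_integrable_on {p..q} \<and> (\<forall>x\<in>{p..q}. u x = u p + integral {p..x} v)"

lemma primitive_abs_int: "primitive p q v u \<Longrightarrow> v absolutely_integrable_on {p..q}"
  unfolding primitive_def by (rule conjunct1)

lemma primitive_integrable: "primitive p q v u \<Longrightarrow> v integrable_on {p..q}"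
  using primitive_abs_int absolutely_integrable_on_def by blast

lemma primitive_eq:
  assumes "primitive p q v u" "p \<le> x" "x \<le> q"
  shows "u x = u p + integral {p..x} v"
  using assms unfolding primitive_def by (metis atLeastAtMost_iff)

lemma primitiveI:
  assumes "v absolutely_integrable_on {p..q}" "\<And>x. p \<le> x \<Longrightarrow> x \<le> q \<Longrightarrow> u x = c + integral {p..x} v"
  shows "primitive p q v u"
proof -
  have "u p = c" if "p \<le> q" using assms(2)[of p] that by simp
  then have "\<forall>x\<in>{p..q}. u x = u p + integral {p..x} v"
    using assms(2) by (metis atLeastAtMost_iff order_trans)
  then show ?thesis using assms(1) by (simp only: primitive_def)
qed

lemma primitive_diff:
  assumes "primitive p q v u" "p \<le> x" "x \<le> y" "y \<le> q"
  shows "u y - u x = integral {x..y} v"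
  using integral_Icc_diff[OF primitive_integrable[OF assms(1)] assms(2-4)]
    primitive_eq[OF assms(1), of x] primitive_eq[OF assms(1), of y] assms(2-4) by simp

lemma primitive_integrableD:
  assumes "primitive p q v u" "p \<le> x" "y \<le> q"
  shows "v absolutely_integrable_on {x..y}"
  using primitive_abs_int[OF assms(1)] assms(2,3)
  by (meson absolutely_integrable_on_subinterval atLeastatMost_subset_iff)

lemma primitive_subinterval:
  assumes "primitive p q v u" "p \<le> x" "y \<le> q"
  shows "primitive x y v u"
proof (rule primitiveI[where c = "u x"])
  show "v absolutely_integrable_on {x..y}" using primitive_integrableD[OF assms] .
  show "u z = u x + integral {x..z} v" if "x \<le> z" "z \<le> y" for z
    using primitive_diff[OF assms(1), of x z] that assms by (simp add: algebra_simps)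
qed

lemma primitive_continuous:
  assumes "primitive p q v u"
  shows "continuous_on {p..q} u"
proof -
  have "continuous_on {p..q} (\<lambda>x. u p + integral {p..x} v)"
    by (intro continuous_intros indefinite_integral_continuous_1 primitive_integrable[OF assms])
  then show ?thesis
    by (rule continuous_on_eq) (metis assms primitive_eq atLeastAtMost_iff)
qed

lemma primitive_cong:
  assumes "primitive p q v u" "\<And>x. x \<in> {p..q} \<Longrightarrow> v x = v' x" "\<And>x. x \<in> {p..q} \<Longrightarrow> u x = u' x"
  shows "primitive p q v' u'"
proof (rule primitiveI[where c = "u p"])
  show "v' absolutely_integrable_on {p..q}"
  proof -
    have "set_integrable lebesgue {p..q} v = set_integrable lebesgue {p..q} v'"
      by (rule set_integrable_cong) (use assms(2) in auto)
    then show ?thesis using primitive_abs_int[OF assms(1)] by simp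
  qed
  show "u' x = u p + integral {p..x} v'" if "p \<le> x" "x \<le> q" for x
  proof -
    have "integral {p..x} v = integral {p..x} v'"
      by (rule Henstock_Kurzweil_Integration.integral_cong) (use assms(2) that in auto)
    then show ?thesis
      using primitive_eq[OF assms(1) that] assms(3)[of x] that by simp
  qed
qed

lemma primitive_cmult:
  assumes "primitive p q v u"
  shows "primitive p q (\<lambda>x. c * v x) (\<lambda>x. c * u x)"
proof (rule primitiveI[where c = "c * u p"])
  show "(\<lambda>x. c * v x) absolutely_integrable_on {p..q}"
    by (rule set_integrable_mult_right[OF primitive_abs_int[OF assms]])
  show "c * u x = c * u p + integral {p..x} (\<lambda>x. c * v x)" if "p \<le> x" "x \<le> q" for x
    using primitive_eq[OF assms that] by (simp add: distrib_left)
qed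

lemma norm_integral_le:
  fixes f :: "real \<Rightarrow> complex"
  assumes "f absolutely_integrable_on {x..y}" "g integrable_on {x..y}"
    "\<And>s. x \<le> s \<Longrightarrow> s \<le> y \<Longrightarrow> norm (f s) \<le> g s"
  shows "norm (integral {x..y} f) \<le> integral {x..y} g"
  using assms by (intro integral_norm_bound_integral)
    (auto simp: absolutely_integrable_on_def)

lemma abs_int_mult_bounded:
  fixes f g :: "real \<Rightarrow> complex"
  assumes "f \<in> borel_measurable (lebesgue_on {p..q})" "\<And>x. x \<in> {p..q} \<Longrightarrow> norm (f x) \<le> C"
    "g absolutely_integrable_on {p..q}"
  shows "(\<lambda>x. f x * g x) absolutely_integrable_on {p..q}"
proof (rule absolutely_integrable_bounded_measurable_product[OF _ assms(1) _ _ assms(3)])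
  show "bilinear ((*) :: complex \<Rightarrow> complex \<Rightarrow> complex)"
    using bilinear_conv_bounded_bilinear bounded_bilinear_mult by blast
  show "bounded (f ` {p..q})"
    using assms(2) unfolding bounded_iff by blast
qed auto

lemma continuous_measurable_Icc:
  fixes f :: "real \<Rightarrow> complex"
  assumes "continuous_on {p..q} f"
  shows "f \<in> borel_measurable (lebesgue_on {p..q})"
  by (rule continuous_imp_measurable_on_sets_lebesgue[OF assms]) simp

lemma continuous_bounded_Icc:
  fixes f :: "real \<Rightarrow> complex"
  assumes "continuous_on {p..q} f"
  obtains B where "B \<ge> 0" "\<And>x. x \<in> {p..q} \<Longrightarrow> norm (f x) \<le> B"
proof -
  have "bounded (f ` {p..q})"
    by (intro compact_imp_bounded compact_continuous_image assms) auto
  then obtain B where "\<forall>x\<in>{p..q}. norm (f x) \<le> B" by (auto simp: bounded_iff)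
  then show ?thesis by (intro that[of "max B 0"]) (auto simp: le_max_iff_disj)
qed

lemma abs_int_mult_continuous:
  fixes f g :: "real \<Rightarrow> complex"
  assumes "continuous_on {p..q} f" "g absolutely_integrable_on {p..q}"
  shows "(\<lambda>x. f x * g x) absolutely_integrable_on {p..q}"
  using continuous_bounded_Icc[OF assms(1)] continuous_measurable_Icc[OF assms(1)] assms(2)
  by (metis abs_int_mult_bounded)

text \<open>
  Let \<open>D\<close> be \<open>m w\<close> minus the integral of \<open>m' w + m h\<close>. Up to integrals of
  \<open>m' (w - w x)\<close> and \<open>(m - m x) h\<close>, the increment of \<open>D\<close> over \<open>[x, y]\<close> is the product of the
  increments of \<open>m\<close> and \<open>w\<close>. As \<open>m\<close> is Lipschitz, each of these three terms is at most
  \<open>C (y - x)\<close> times the integral of \<open>|h|\<close> over \<open>[x, y]\<close>, so \<open>D\<close> is constant.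
\<close>

lemma primitive_mult:
  assumes m: "primitive p q m' m" and w: "primitive p q h w"
    and bound: "\<And>x. x \<in> {p..q} \<Longrightarrow> norm (m' x) \<le> C"
  shows "primitive p q (\<lambda>x. m' x * w x + m x * h x) (\<lambda>x. m x * w x)"
proof -
  let ?r = "\<lambda>x. m' x * w x + m x * h x"
  let ?G = "\<lambda>x. integral {p..x} (\<lambda>s. norm (h s))"
  have m'_int: "m' absolutely_integrable_on {p..q}" and h_int: "h absolutely_integrable_on {p..q}"
    using m w by (auto intro: primitive_abs_int)
  have mw_int: "(\<lambda>x. m' x * w x) absolutely_integrable_on {p..q}"
    using abs_int_mult_continuous[OF primitive_continuous[OF w] m'_int] by (simp add: mult.commute)
  have mh_int: "(\<lambda>x. m x * h x) absolutely_integrable_on {p..q}"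
    by (rule abs_int_mult_continuous[OF primitive_continuous[OF m] h_int])
  have r_int: "?r absolutely_integrable_on {p..q}"
    by (intro set_integral_add mw_int mh_int)
  define D where "D x = m x * w x - integral {p..x} ?r" for x
  have norm_h: "(\<lambda>s. norm (h s)) integrable_on {p..q}"
    using h_int by (auto simp: absolutely_integrable_on_def)
  have D_bound: "norm (D y - D x) \<le> (3 * C) * (y - x) * (?G y - ?G x)"
    if xy: "p \<le> x" "x \<le> y" "y \<le> q" for x y
  proof -
    have sub: "f absolutely_integrable_on {x..y}" if "f absolutely_integrable_on {p..q}"
      for f :: "real \<Rightarrow> complex"
      using that xy by (meson absolutely_integrable_on_subinterval atLeastatMost_subset_iff)
    have C0: "C \<ge> 0" using bound[of x] norm_ge_zero[of "m' x"] xy by (auto simp del: norm_ge_zero)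
    have Gdiff: "?G y - ?G x = integral {x..y} (\<lambda>s. norm (h s))"
      by (rule integral_Icc_diff[OF norm_h xy])
    have hxy: "(\<lambda>s. norm (h s)) integrable_on {x..y}"
      by (rule integrable_on_subinterval[OF norm_h]) (use xy in auto)
    have m_bd: "norm (m s - m x) \<le> C * (y - x)" if "x \<le> s" "s \<le> y" for s
    proof -
      have "m s - m x = integral {x..s} m'"
        using primitive_diff[OF m, of x s] xy that by auto
      also have "norm \<dots> \<le> integral {x..s} (\<lambda>_. C)"
        by (rule norm_integral_le) (use primitive_integrableD[OF m] xy that bound in auto)
      also have "\<dots> = C * (s - x)" using that by simp
      also have "\<dots> \<le> C * (y - x)" using that C0 by (intro mult_left_mono) auto
      finally show ?thesis .
    qed
    have w_bd: "norm (w s - w x) \<le> ?G y - ?G x" if "x \<le> s" "s \<le> y" for s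
    proof -
      have hs: "(\<lambda>s. norm (h s)) integrable_on {x..s}"
        by (rule integrable_on_subinterval[OF norm_h]) (use xy that in auto)
      have "w s - w x = integral {x..s} h"
        using primitive_diff[OF w, of x s] xy that by auto
      also have "norm \<dots> \<le> integral {x..s} (\<lambda>s. norm (h s))"
        by (rule norm_integral_le) (use primitive_integrableD[OF w] xy that hs in auto)
      also have "\<dots> \<le> integral {x..y} (\<lambda>s. norm (h s))"
        by (rule integral_subset_le) (use that hs hxy in auto)
      finally show ?thesis using Gdiff by simp
    qed
    have int1: "(\<lambda>s. m' s * (w s - w x)) absolutely_integrable_on {x..y}"
      using set_integral_diff(1)[OF sub[OF mw_int] set_integrable_mult_left[of "w x", OF sub[OF m'_int]]]
      by (simp add: algebra_simps)
    have int2: "(\<lambda>s. (m s - m x) * h s) absolutely_integrable_on {x..y}"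
      using set_integral_diff(1)[OF sub[OF mh_int] set_integrable_mult_right[of "m x", OF sub[OF h_int]]]
      by (simp add: algebra_simps)
    have r_split: "integral {x..y} ?r = integral {x..y} (\<lambda>s. m' s * (w s - w x))
        + integral {x..y} (\<lambda>s. (m s - m x) * h s) + (m y - m x) * w x + m x * (w y - w x)"
    proof -
      have "?r = (\<lambda>s. (m' s * (w s - w x) + (m s - m x) * h s) + (m' s * w x + m x * h s))"
        by (auto simp: algebra_simps)
      then have "integral {x..y} ?r = integral {x..y} (\<lambda>s. (m' s * (w s - w x) + (m s - m x) * h s) + (m' s * w x + m x * h s))"
        by simp
      also have "\<dots> = (integral {x..y} (\<lambda>s. m' s * (w s - w x)) + integral {x..y} (\<lambda>s. (m s - m x) * h s))
         + (integral {x..y} m' * w x + m x * integral {x..y} h)"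
        using int1 int2 sub[OF m'_int] sub[OF h_int]
        by (subst Henstock_Kurzweil_Integration.integral_add, auto simp: absolutely_integrable_on_def
           intro!: integrable_add integrable_on_mult_left integrable_on_mult_right)+
      finally show ?thesis
        using primitive_diff[OF m xy] primitive_diff[OF w xy] by (simp add: algebra_simps)
    qed
    have "integral {p..y} ?r - integral {p..x} ?r = integral {x..y} ?r"
      by (rule integral_Icc_diff[OF _ xy]) (use r_int absolutely_integrable_on_def in blast)
    then have D_eq: "D y - D x = (m y - m x) * (w y - w x) - integral {x..y} (\<lambda>s. m' s * (w s - w x))
        - integral {x..y} (\<lambda>s. (m s - m x) * h s)"
      unfolding D_def using r_split by (simp add: algebra_simps)
    have b1: "norm ((m y - m x) * (w y - w x)) \<le> C * (y - x) * (?G y - ?G x)"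
      unfolding norm_mult using m_bd[of y] w_bd[of y] xy C0 by (intro mult_mono) auto
    have b2: "norm (integral {x..y} (\<lambda>s. m' s * (w s - w x))) \<le> C * (y - x) * (?G y - ?G x)"
    proof -
      have "norm (integral {x..y} (\<lambda>s. m' s * (w s - w x))) \<le> integral {x..y} (\<lambda>_. C * (?G y - ?G x))"
      proof (rule norm_integral_le[OF int1])
        show "norm (m' s * (w s - w x)) \<le> C * (?G y - ?G x)" if "x \<le> s" "s \<le> y" for s
          unfolding norm_mult using bound[of s] w_bd[OF that] C0 that xy by (intro mult_mono) auto
      qed auto
      also have "\<dots> = C * (y - x) * (?G y - ?G x)" using xy by simp
      finally show ?thesis .
    qed
    have b3: "norm (integral {x..y} (\<lambda>s. (m s - m x) * h s)) \<le> C * (y - x) * (?G y - ?G x)"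
    proof -
      have "norm (integral {x..y} (\<lambda>s. (m s - m x) * h s)) \<le> integral {x..y} (\<lambda>s. C * (y - x) * norm (h s))"
      proof (rule norm_integral_le[OF int2])
        show "norm ((m s - m x) * h s) \<le> C * (y - x) * norm (h s)" if "x \<le> s" "s \<le> y" for s
          unfolding norm_mult using m_bd[OF that] by (intro mult_right_mono) auto
      qed (intro integrable_on_mult_right hxy)
      also have "\<dots> = C * (y - x) * (?G y - ?G x)" using Gdiff by simp
      finally show ?thesis .
    qed
    have "norm (D y - D x) \<le> C * (y - x) * (?G y - ?G x) + C * (y - x) * (?G y - ?G x)
        + C * (y - x) * (?G y - ?G x)"
      unfolding D_eq by (intro add_mono b1 b2 b3 order_trans[OF norm_triangle_ineq4])
    also have "\<dots> = (3 * C) * (y - x) * (?G y - ?G x)"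
      by algebra
    finally show ?thesis .
  qed
  show ?thesis
  proof (rule primitiveI[OF r_int])
    fix x assume x: "p \<le> x" "x \<le> q"
    have "D x = D p" by (rule eq_if_increments_product_bounded[OF D_bound x])
    then show "m x * w x = m p * w p + integral {p..x} ?r"
      by (simp add: D_def algebra_simps)
  qed
qed

text \<open>
  As for the product: the first-order Taylor error of \<open>exp\<close> and the oscillation of \<open>exp g\<close> make the
  increments of \<open>exp g\<close> minus the integral of \<open>b exp g\<close> quadratically small, because \<open>g\<close> is
  Lipschitz.
\<close>

lemma primitive_exp:
  assumes g: "primitive p q b g" and bound: "\<And>x. x \<in> {p..q} \<Longrightarrow> norm (b x) \<le> C"
  shows "primitive p q (\<lambda>x. b x * exp (g x)) (\<lambda>x. exp (g x))"
proof -
  let ?r = "\<lambda>x. b x * exp (g x)"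
  have b_int: "b absolutely_integrable_on {p..q}" using g by (rule primitive_abs_int)
  have e_cont: "continuous_on {p..q} (\<lambda>x. exp (g x))"
    by (intro continuous_intros primitive_continuous[OF g])
  have r_int: "?r absolutely_integrable_on {p..q}"
    using abs_int_mult_continuous[OF e_cont b_int] by (simp add: mult.commute)
  obtain B where B: "B \<ge> 0" "\<And>x. x \<in> {p..q} \<Longrightarrow> norm (exp (g x)) \<le> B"
    using continuous_bounded_Icc[OF e_cont] by metis
  define K where "K = (exp (C * (q - p)) * C^2 * B)"
  define D where "D x = exp (g x) - integral {p..x} ?r" for x
  have exp_bd: "norm (exp z - 1) \<le> exp R * norm z"
    and exp_bd2: "norm (exp z - 1 - z) \<le> exp R * (norm z)^2" if "norm z \<le> R" for z :: complex and R
  proof -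
    have R: "exp \<bar>Re z\<bar> \<le> exp R" using that abs_Re_le_cmod[of z] by simp
    have "norm (exp z - (\<Sum>i\<le>0. z ^ i / fact i)) \<le> exp \<bar>Re z\<bar> * (norm z ^ Suc 0) / fact 0"
      by (rule Taylor_exp)
    then show "norm (exp z - 1) \<le> exp R * norm z"
      using mult_right_mono[OF R norm_ge_zero[of z]] by simp
    have "norm (exp z - (\<Sum>i\<le>1. z ^ i / fact i)) \<le> exp \<bar>Re z\<bar> * (norm z ^ Suc 1) / fact 1"
      by (rule Taylor_exp)
    then show "norm (exp z - 1 - z) \<le> exp R * (norm z)^2"
      using mult_right_mono[OF R, of "(norm z)\<^sup>2"] by (simp add: power2_eq_square algebra_simps)
  qed
  have D_bound: "norm (D y - D x) \<le> (2 * K) * (y - x) * (y - x)"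
    if xy: "p \<le> x" "x \<le> y" "y \<le> q" for x y
  proof -
    have sub: "f absolutely_integrable_on {x..y}" if "f absolutely_integrable_on {p..q}"
      for f :: "real \<Rightarrow> complex"
      using that xy by (meson absolutely_integrable_on_subinterval atLeastatMost_subset_iff)
    have C0: "C \<ge> 0" using bound[of x] norm_ge_zero[of "b x"] xy by (auto simp del: norm_ge_zero)
    have g_bd: "norm (g s - g x) \<le> C * (y - x)" if "x \<le> s" "s \<le> y" for s
    proof -
      have "g s - g x = integral {x..s} b"
        using primitive_diff[OF g, of x s] xy that by auto
      also have "norm \<dots> \<le> integral {x..s} (\<lambda>_. C)"
        by (rule norm_integral_le) (use primitive_integrableD[OF g] xy that bound in auto)
      also have "\<dots> = C * (s - x)" using that by simp
      also have "\<dots> \<le> C * (y - x)" using that C0 by (intro mult_left_mono) auto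
      finally show ?thesis .
    qed
    have Cyx: "C * (y - x) \<le> C * (q - p)" using xy C0 by (intro mult_left_mono) auto
    have Bx: "norm (exp (g x)) \<le> B" using B xy by auto
    have int1: "(\<lambda>s. b s * (exp (g s) - exp (g x))) absolutely_integrable_on {x..y}"
      using set_integral_diff(1)[OF sub[OF r_int] set_integrable_mult_left[of "exp (g x)", OF sub[OF b_int]]]
      by (simp add: algebra_simps)
    have r_split: "integral {x..y} ?r = integral {x..y} (\<lambda>s. b s * (exp (g s) - exp (g x)))
        + (g y - g x) * exp (g x)"
    proof -
      have "?r = (\<lambda>s. b s * (exp (g s) - exp (g x)) + b s * exp (g x))"
        by (auto simp: algebra_simps)
      then have "integral {x..y} ?r = integral {x..y} (\<lambda>s. b s * (exp (g s) - exp (g x)) + b s * exp (g x))"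
        by simp
      also have "\<dots> = integral {x..y} (\<lambda>s. b s * (exp (g s) - exp (g x))) + integral {x..y} b * exp (g x)"
        using int1 sub[OF b_int]
        by (subst Henstock_Kurzweil_Integration.integral_add) (auto simp: absolutely_integrable_on_def
           intro!: integrable_on_mult_left)
      finally show ?thesis
        using primitive_diff[OF g xy] by simp
    qed
    have "integral {p..y} ?r - integral {p..x} ?r = integral {x..y} ?r"
      by (rule integral_Icc_diff[OF _ xy]) (use r_int absolutely_integrable_on_def in blast)
    then have D_eq: "D y - D x = exp (g x) * (exp (g y - g x) - 1 - (g y - g x))
        - integral {x..y} (\<lambda>s. b s * (exp (g s) - exp (g x)))"
      unfolding D_def using r_split by (simp add: algebra_simps exp_diff)
    have b1: "norm (exp (g x) * (exp (g y - g x) - 1 - (g y - g x))) \<le> K * (y - x) * (y - x)"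
    proof -
      have "norm (exp (g y - g x) - 1 - (g y - g x)) \<le> exp (C * (q - p)) * (norm (g y - g x))^2"
        by (rule exp_bd2) (use g_bd[of y] Cyx xy in auto)
      also have "\<dots> \<le> exp (C * (q - p)) * (C * (y - x))^2"
        using g_bd[of y] xy by (intro mult_left_mono power_mono) auto
      finally have "norm (exp (g x) * (exp (g y - g x) - 1 - (g y - g x))) \<le> B * (exp (C * (q - p)) * (C * (y - x))^2)"
        unfolding norm_mult using Bx B(1) by (intro mult_mono) auto
      then show ?thesis by (simp add: K_def power2_eq_square mult_ac)
    qed
    have b2: "norm (integral {x..y} (\<lambda>s. b s * (exp (g s) - exp (g x)))) \<le> K * (y - x) * (y - x)"
    proof -
      have "norm (integral {x..y} (\<lambda>s. b s * (exp (g s) - exp (g x)))) \<le> integral {x..y} (\<lambda>_. K * (y - x))"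
      proof (rule norm_integral_le[OF int1])
        fix s assume s: "x \<le> s" "s \<le> y"
        have diff: "exp (g s) - exp (g x) = exp (g x) * (exp (g s - g x) - 1)"
          by (simp add: exp_diff algebra_simps)
        have "norm (exp (g s - g x) - 1) \<le> exp (C * (q - p)) * norm (g s - g x)"
          by (rule exp_bd) (use g_bd[OF s] Cyx xy in auto)
        also have "\<dots> \<le> exp (C * (q - p)) * (C * (y - x))"
          using g_bd[OF s] by (intro mult_left_mono) auto
        finally have "norm (exp (g s) - exp (g x)) \<le> B * (exp (C * (q - p)) * (C * (y - x)))"
          unfolding diff norm_mult by (rule mult_mono[OF Bx]) (use B(1) in auto)
        then have "norm (b s * (exp (g s) - exp (g x))) \<le> C * (B * (exp (C * (q - p)) * (C * (y - x))))"
          unfolding norm_mult using bound[of s] C0 s xy by (intro mult_mono) auto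
        then show "norm (b s * (exp (g s) - exp (g x))) \<le> K * (y - x)"
          by (simp add: K_def power2_eq_square mult_ac)
      qed auto
      also have "\<dots> = K * (y - x) * (y - x)" using xy by simp
      finally show ?thesis .
    qed
    have "norm (D y - D x) \<le> K * (y - x) * (y - x) + K * (y - x) * (y - x)"
      unfolding D_eq by (intro add_mono b1 b2 order_trans[OF norm_triangle_ineq4])
    also have "\<dots> = (2 * K) * (y - x) * (y - x)"
      by algebra
    finally show ?thesis .
  qed
  show ?thesis
  proof (rule primitiveI[OF r_int])
    fix x assume x: "p \<le> x" "x \<le> q"
    have "D x = D p" by (rule eq_if_increments_product_bounded[OF D_bound x])
    then show "exp (g x) = exp (g p) + integral {p..x} ?r"
      by (simp add: D_def algebra_simps)
  qed
qed

text \<open>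
  The sets over which \<open>g\<close>, extended by zero, has integral zero form a Dynkin system. It contains
  all half-lines, which are closed under intersection and generate the Borel sets.
\<close>

lemma AE_zero_if_integrals_zero:
  fixes g :: "real \<Rightarrow> complex"
  assumes g: "g absolutely_integrable_on {p..q}"
    and zero: "\<And>x. p \<le> x \<Longrightarrow> x \<le> q \<Longrightarrow> integral {p..x} g = 0"
  shows "AE x in lebesgue_on {p..q}. g x = 0"
proof (cases "p \<le> q")
  case pq: True
  define h where "h x = indicat_real {p..q} x *\<^sub>R g x" for x
  have h: "integrable lebesgue h"
    using g unfolding set_integrable_def h_def .
  have hI: "set_integrable lebesgue A h" if "A \<in> sets lebesgue" for A
    using integrable_mult_indicator[OF that h] by (simp add: set_integrable_def)
  have interval: "(LINT x:{..z}|lebesgue. h x) = 0" for z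
  proof -
    have "(LINT x:{..z}|lebesgue. h x) = (LINT x:{p..min z q}|lebesgue. g x)"
      unfolding set_lebesgue_integral_def h_def
      by (rule Bochner_Integration.integral_cong) (auto simp: indicator_def)
    also have "\<dots> = integral {p..min z q} g"
      by (rule set_lebesgue_integral_eq_integral)
         (rule set_integrable_subset[OF g], auto)
    also have "\<dots> = 0" using zero[of "min z q"] pq by (cases "p \<le> z") auto
    finally show ?thesis .
  qed
  have total: "(LINT x|lebesgue. h x) = 0"
  proof -
    have "(LINT x|lebesgue. h x) = (LINT x:{..q}|lebesgue. h x)"
      unfolding set_lebesgue_integral_def h_def
      by (rule Bochner_Integration.integral_cong) (auto simp: indicator_def)
    then show ?thesis using interval by simp
  qed
  have borel: "(LINT x:A|lebesgue. h x) = 0" if "A \<in> sets borel" for A :: "real set"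
  proof -
    have gen: "sets (borel :: real measure) = sigma_sets UNIV (range (\<lambda>x::real. {..x}))"
      by (subst borel_eq_atMost) (simp add: sets_measure_of)
    have gen_leb: "B \<in> sets lebesgue" if "B \<in> sigma_sets UNIV (range (\<lambda>x::real. {..x}))" for B
    proof -
      have "B \<in> sets borel" using that unfolding gen .
      then show ?thesis by (simp add: sets_completionI_sets)
    qed
    have stable: "Int_stable (range (\<lambda>x::real. {..x}))"
      by (auto simp: Int_stable_def)
    have sub: "range (\<lambda>x::real. {..x}) \<subseteq> Pow UNIV"
      by simp
    have "A \<in> sigma_sets UNIV (range (\<lambda>x::real. {..x}))"
      using that gen by simp
    from stable sub this show ?thesis
    proof (induction rule: sigma_sets_induct_disjoint)
      case (basic A)
      then show ?case using interval by auto
    next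
      case empty
      then show ?case by (simp add: set_lebesgue_integral_def)
    next
      case (compl A)
      have A: "A \<in> sets lebesgue" using compl(1) by (rule gen_leb)
      then have A': "UNIV - A \<in> sets lebesgue"
        using sets.compl_sets[of A lebesgue] by simp
      have "(LINT x:A|lebesgue. h x) + (LINT x:UNIV - A|lebesgue. h x) = (LINT x:A \<union> (UNIV - A)|lebesgue. h x)"
        by (rule set_integral_Un[symmetric]) (use A A' hI in auto)
      also have "\<dots> = 0" using total by (simp add: set_lebesgue_integral_def)
      finally show ?case using compl by simp
    next
      case (union A)
      have A: "A i \<in> sets lebesgue" for i
        using union(2) by (intro gen_leb) blast
      have "(LINT x:(\<Union>i. A i)|lebesgue. h x) = (\<Sum>i. (LINT x:A i|lebesgue. h x))"
        by (rule lebesgue_integral_countable_add)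
           (use A union(1) hI in \<open>auto simp: disjoint_family_on_def\<close>)
      then show ?case using union by simp
    qed
  qed
  have leb: "(LINT x:A|lebesgue. h x) = 0" if A: "A \<in> sets lebesgue" for A
  proof -
    obtain C T where CT: "fsigma C" "T \<in> null_sets lebesgue" "C \<union> T = A" "disjnt C T"
      using lebesgue_set_almost_fsigma[OF A] .
    have C: "C \<in> sets borel" using CT(1) by (cases rule: fsigma.cases) auto
    have "(LINT x:A|lebesgue. h x) = (LINT x:C|lebesgue. h x)"
      unfolding set_lebesgue_integral_def
    proof (rule integral_cong_AE)
      show "AE x in lebesgue. indicat_real A x *\<^sub>R h x = indicat_real C x *\<^sub>R h x"
        using AE_not_in[OF CT(2)] by eventually_elim (use CT in \<open>auto simp: indicator_def\<close>)
    qed (use h A C in \<open>auto intro!: borel_measurable_scaleR borel_measurable_indicator\<close>)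
    then show ?thesis using borel[OF C] by simp
  qed
  interpret finite_measure "lebesgue_on {p..q}"
    by (rule finite_measure_lebesgue_on) simp
  show ?thesis
  proof (rule density_zero)
    show "integrable (lebesgue_on {p..q}) g"
      by (rule absolutely_integrable_imp_integrable[OF g]) simp
    fix A assume "A \<in> sets (lebesgue_on {p..q})"
    then have A: "A \<in> sets lebesgue" by (simp add: sets_restrict_space_iff)
    have "(LINT x:A|lebesgue_on {p..q}. g x) = (LINT x:A|lebesgue. h x)"
      unfolding set_lebesgue_integral_def h_def
      by (subst integral_restrict_space) (auto simp: mult.commute)
    then show "(LINT x:A|lebesgue_on {p..q}. g x) = 0" using leb[OF A] by simp
  qed
next
  case False
  then show ?thesis by (subst AE_restrict_space_iff) auto
qed

section \<open>Smooth bumps and the lemma of du Bois-Reymond\<close>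

text \<open>
  The factors \<open>x ^ k\<close> in the denominator make the family closed under differentiation up to
  linear combinations, which replaces a computation of all derivatives of \<open>exp (- 1 / x)\<close>.
\<close>

definition flat_exp :: "nat \<Rightarrow> real \<Rightarrow> real" where
  "flat_exp k x = (if x > 0 then exp (- (1 / x)) / x ^ k else 0)"

lemma flat_exp_tendsto_0: "(flat_exp k \<longlongrightarrow> 0) (at 0)"
proof -
  have "((\<lambda>x::real. (1 / x) ^ k / exp (1 / x)) \<longlongrightarrow> 0) (at_right 0)"
    by (rule filterlim_compose[OF tendsto_power_div_exp_0])
       (simp add: filterlim_inverse_at_top_right flip: inverse_eq_divide)
  moreover have "eventually (\<lambda>x. (1 / x) ^ k / exp (1 / x) = flat_exp k x) (at_right 0)"
    unfolding eventually_at_right_field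
    by (auto simp: flat_exp_def exp_minus power_divide field_simps intro!: exI[of _ 1])
  ultimately have "(flat_exp k \<longlongrightarrow> 0) (at_right 0)"
    by (rule Lim_transform_eventually)
  moreover have "(flat_exp k \<longlongrightarrow> 0) (at_left 0)"
    by (rule Lim_transform_eventually[OF tendsto_const])
       (auto simp: eventually_at_left_field flat_exp_def intro!: exI[of _ "-1"])
  ultimately show ?thesis by (simp add: filterlim_split_at)
qed

text \<open>
  At the origin the difference quotient of \<open>flat_exp k\<close> is \<open>flat_exp (k + 1)\<close>, which tends to
  zero.
\<close>

lemma flat_exp_deriv:
  "(flat_exp k has_real_derivative (flat_exp (k + 2) x - real k * flat_exp (k + 1) x)) (at x)"
proof -
  consider "x > 0" | "x < 0" | "x = 0" by linarith
  then show ?thesis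
  proof cases
    case 1
    have "((\<lambda>x. exp (- (1 / x)) / x ^ k) has_real_derivative
        (flat_exp (k + 2) x - real k * flat_exp (k + 1) x)) (at x)"
      using 1 by (auto intro!: derivative_eq_intros simp: flat_exp_def)
         (cases k; simp add: field_simps power2_eq_square)
    then show ?thesis
      by (rule has_field_derivative_transform_within_open[of _ _ _ "{0<..}"])
         (use 1 in \<open>auto simp: flat_exp_def\<close>)
  next
    case 2
    have "((\<lambda>x. 0) has_real_derivative
        (flat_exp (k + 2) x - real k * flat_exp (k + 1) x)) (at x)"
      using 2 by (auto simp: flat_exp_def)
    then show ?thesis
      by (rule has_field_derivative_transform_within_open[of _ _ _ "{..<0}"])
         (use 2 in \<open>auto simp: flat_exp_def\<close>)
  next
    case 3
    have "((\<lambda>h. (flat_exp k h - flat_exp k 0) / (h - 0)) \<longlongrightarrow> 0) (at 0)"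
      by (rule Lim_transform_eventually[OF flat_exp_tendsto_0[of "Suc k"]])
         (auto simp: eventually_at flat_exp_def intro!: exI[of _ 1])
    then show ?thesis
      unfolding has_field_derivative_iff using 3 by (simp add: flat_exp_def)
  qed
qed

text \<open>
  A supply of test functions closed under linear combinations and, by \<open>flat_exp_deriv\<close>, under
  differentiation. Letting the scale \<open>c\<close> tend to infinity yields bumps on \<open>[\<alpha>, \<beta>]\<close> that converge
  to the indicator function of \<open>(\<alpha>, \<beta>)\<close>.
\<close>

inductive bump :: "real \<Rightarrow> real \<Rightarrow> (real \<Rightarrow> real) \<Rightarrow> bool" for p q where
  product: "p < \<alpha> \<Longrightarrow> \<alpha> < \<beta> \<Longrightarrow> \<beta> < q \<Longrightarrow>
     bump p q (\<lambda>x. flat_exp j (c * (x - \<alpha>)) * flat_exp k (c * (\<beta> - x)))" if "c > 0" for c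
| combination: "bump p q f \<Longrightarrow> bump p q g \<Longrightarrow> bump p q (\<lambda>x. a * f x + b * g x)"

lemma bump_has_bump_derivative:
  assumes "bump p q f"
  shows "\<exists>f'. bump p q f' \<and> (\<forall>x. (f has_real_derivative f' x) (at x))"
  using assms
proof (induction rule: bump.induct)
  case (product c \<alpha> \<beta> j k)
  define b where "b i l = (\<lambda>x. flat_exp i (c * (x - \<alpha>)) * flat_exp l (c * (\<beta> - x)))" for i l
  have b: "bump p q (b i l)" for i l
    unfolding b_def by (rule bump.product) (use product in auto)
  have d1: "((\<lambda>x. flat_exp i (c * (x - \<alpha>))) has_real_derivative
      (flat_exp (i + 2) (c * (x - \<alpha>)) - real i * flat_exp (i + 1) (c * (x - \<alpha>))) * c) (at x)" for i x
    by (rule DERIV_chain2[OF flat_exp_deriv]) (auto intro!: derivative_eq_intros)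
  have d2: "((\<lambda>x. flat_exp i (c * (\<beta> - x))) has_real_derivative
      (flat_exp (i + 2) (c * (\<beta> - x)) - real i * flat_exp (i + 1) (c * (\<beta> - x))) * (- c)) (at x)" for i x
    by (rule DERIV_chain2[OF flat_exp_deriv]) (auto intro!: derivative_eq_intros)
  let ?f' = "\<lambda>x. 1 * (c * b (j + 2) k x + (- c * real j) * b (j + 1) k x)
     + 1 * ((- c) * b j (k + 2) x + (c * real k) * b j (k + 1) x)"
  have "bump p q ?f'"
    by (intro bump.combination b)
  moreover have "(b j k has_real_derivative ?f' x) (at x)" for x
    unfolding b_def by (rule DERIV_cong[OF DERIV_mult[OF d1 d2]]) (simp add: algebra_simps)
  ultimately show ?case unfolding b_def by blast
next
  case (combination f g a b)
  then obtain f' g' where *: "bump p q f'" "bump p q g'"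
    "\<And>x. (f has_real_derivative f' x) (at x)" "\<And>x. (g has_real_derivative g' x) (at x)" by blast
  have "((\<lambda>x. a * f x + b * g x) has_real_derivative a * f' x + b * g' x) (at x)" for x
    by (auto intro!: derivative_eq_intros *)
  then show ?case using bump.combination[OF *(1,2)] by blast
qed

lemma bump_higher_deriv: "bump p q f \<Longrightarrow> bump p q ((deriv ^^ m) f)"
proof (induction m)
  case (Suc m)
  then obtain f' where f': "bump p q f'" "\<forall>x. ((deriv ^^ m) f has_real_derivative f' x) (at x)"
    using bump_has_bump_derivative by blast
  then have "deriv ((deriv ^^ m) f) = f'" by (auto intro: DERIV_imp_deriv)
  then show ?case using f' by simp
qed auto

lemma bump_smooth: "bump p q f \<Longrightarrow> (deriv ^^ m) f field_differentiable (at x)"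
  using bump_has_bump_derivative[OF bump_higher_deriv] field_differentiable_def by blast

lemma bump_continuous: "bump p q f \<Longrightarrow> continuous_on S f"
  using bump_has_bump_derivative by (metis DERIV_isCont continuous_at_imp_continuous_on)

lemma bump_support:
  assumes "bump p q f"
  obtains r s where "p < r" "r < s" "s < q" "\<And>x. x \<notin> {r..s} \<Longrightarrow> f x = 0"
proof -
  from assms have "\<exists>r s. p < r \<and> r < s \<and> s < q \<and> (\<forall>x. x \<notin> {r..s} \<longrightarrow> f x = 0)"
  proof (induction rule: bump.induct)
    case (product c \<alpha> \<beta> j k)
    then show ?case
      by (intro exI[of _ \<alpha>] exI[of _ \<beta>]) (auto simp: flat_exp_def zero_less_mult_iff)
  next
    case (combination f g a b)
    then obtain r s r' s' where "p < r" "r < s" "s < q" "p < r'" "r' < s'" "s' < q"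
      and zeros: "\<forall>x. x \<notin> {r..s} \<longrightarrow> f x = 0" "\<forall>x. x \<notin> {r'..s'} \<longrightarrow> g x = 0" by blast
    then have "p < min r r'" "min r r' < max s s'" "max s s' < q" by auto
    moreover have "a * f x + b * g x = 0" if "x \<notin> {min r r'..max s s'}" for x
    proof -
      have "x \<notin> {r..s}" "x \<notin> {r'..s'}" using that by auto
      then show ?thesis using zeros by simp
    qed
    ultimately show ?case by blast
  qed
  then show ?thesis using that by blast
qed

text \<open>
  The zero mean makes the antiderivative vanish to the right of the support too.
\<close>

lemma bump_antiderivative:
  assumes f: "bump p q f" and zero: "integral {p..q} f = 0"
  obtains \<phi> where "\<phi> \<in> test_functions p q" "deriv \<phi> = f"
proof -
  obtain r s where rs: "p < r" "r < s" "s < q" "\<And>x. x \<notin> {r..s} \<Longrightarrow> f x = 0"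
    using bump_support[OF f] by metis
  define \<phi> where "\<phi> x = integral {p..x} f" for x
  have int: "f integrable_on {a..b}" for a b
    by (intro integrable_continuous_real bump_continuous[OF f])
  have left: "\<phi> x = 0" if "x < r" for x
  proof -
    have "integral {p..x} f = integral {p..x} (\<lambda>_. 0)"
      by (rule Henstock_Kurzweil_Integration.integral_cong) (use rs that in auto)
    then show ?thesis by (simp add: \<phi>_def)
  qed
  have tail: "integral {x..y} f = 0" if "s < x" for x y
  proof -
    have "integral {x..y} f = integral {x..y} (\<lambda>_. 0)"
      by (rule Henstock_Kurzweil_Integration.integral_cong) (use rs that in auto)
    then show ?thesis by simp
  qed
  have right: "\<phi> x = 0" if "x > s" for x
  proof (cases "x \<le> q")
    case True
    then have "integral {p..q} f - integral {p..x} f = integral {x..q} f"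
      by (intro integral_Icc_diff[OF int]) (use that rs in auto)
    then show ?thesis
      using tail[OF that, of q] zero by (simp add: \<phi>_def)
  next
    case False
    then have "integral {p..x} f - integral {p..q} f = integral {q..x} f"
      by (intro integral_Icc_diff[OF int]) (use that rs in auto)
    then show ?thesis
      using tail[OF rs(3), of x] zero by (simp add: \<phi>_def)
  qed
  have deriv: "(\<phi> has_real_derivative f x) (at x)" for x
  proof -
    consider "x < r" | "p < x" "x < q" | "x > s" using rs by linarith
    then show ?thesis
    proof cases
      case 1
      have "((\<lambda>_. 0) has_real_derivative f x) (at x)" using 1 rs by auto
      then show ?thesis
        by (rule has_field_derivative_transform_within_open[of _ _ _ "{..<r}"]) (use 1 left in auto)
    next
      case 2
      have "(\<phi> has_real_derivative f x) (at x within {p..q})"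
        unfolding \<phi>_def by (rule integral_has_real_derivative) (use 2 bump_continuous[OF f] in auto)
      then show ?thesis using 2 by (simp add: at_within_Icc_at)
    next
      case 3
      have "((\<lambda>_. 0) has_real_derivative f x) (at x)" using 3 rs by auto
      then show ?thesis
        by (rule has_field_derivative_transform_within_open[of _ _ _ "{s<..}"]) (use 3 right in auto)
    qed
  qed
  then have deriv_eq: "deriv \<phi> = f" by (auto intro: DERIV_imp_deriv)
  have "(deriv ^^ m) \<phi> field_differentiable (at x)" for m x
  proof (cases m)
    case 0
    then show ?thesis using deriv by (auto simp: field_differentiable_def)
  next
    case (Suc l)
    have "(deriv ^^ m) \<phi> = (deriv ^^ l) f"
      by (simp add: Suc funpow_Suc_right deriv_eq del: funpow.simps)
    then show ?thesis using bump_smooth[OF f] by simp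
  qed
  moreover have "\<exists>K. compact K \<and> K \<subseteq> {p<..<q} \<and> (\<forall>x. x \<notin> K \<longrightarrow> \<phi> x = 0)"
    using rs left right by (intro exI[of _ "{r..s}"]) (auto simp: not_le)
  ultimately have "\<phi> \<in> test_functions p q" by (simp add: test_functions_def)
  then show ?thesis using deriv_eq that by blast
qed

lemma test_function_primitive:
  assumes "\<phi> \<in> test_functions p q"
  shows "primitive p q (\<lambda>x. complex_of_real (deriv \<phi> x)) (\<lambda>x. complex_of_real (\<phi> x))"
    and "continuous_on {p..q} (\<lambda>x. complex_of_real (deriv \<phi> x))"
    and "continuous_on {p..q} (\<lambda>x. complex_of_real (\<phi> x))"
    and "\<phi> p = 0" "\<phi> q = 0"
proof -
  have smooth: "(deriv ^^ m) \<phi> field_differentiable (at x)" for m x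
    using assms by (auto simp: test_functions_def)
  have d0: "(\<phi> has_real_derivative deriv \<phi> x) (at x)" for x
    using smooth[of 0 x] by (simp add: DERIV_deriv_iff_field_differentiable)
  have d1: "(deriv \<phi> has_real_derivative deriv (deriv \<phi>) x) (at x)" for x
    using smooth[of 1 x] by (simp add: DERIV_deriv_iff_field_differentiable)
  show cont: "continuous_on {p..q} (\<lambda>x. complex_of_real (deriv \<phi> x))"
    by (intro continuous_intros continuous_at_imp_continuous_on ballI DERIV_isCont[OF d1])
  show "continuous_on {p..q} (\<lambda>x. complex_of_real (\<phi> x))"
    by (intro continuous_intros continuous_at_imp_continuous_on ballI DERIV_isCont[OF d0])
  show "\<phi> p = 0" "\<phi> q = 0"
    using assms by (force simp: test_functions_def)+
  show "primitive p q (\<lambda>x. complex_of_real (deriv \<phi> x)) (\<lambda>x. complex_of_real (\<phi> x))"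
  proof (rule primitiveI)
    show "(\<lambda>x. complex_of_real (deriv \<phi> x)) absolutely_integrable_on {p..q}"
      by (rule absolutely_integrable_continuous_real[OF cont])
    fix x assume x: "p \<le> x" "x \<le> q"
    have "((\<lambda>x. complex_of_real (deriv \<phi> x)) has_integral complex_of_real (\<phi> x) - complex_of_real (\<phi> p)) {p..x}"
      by (rule fundamental_theorem_of_calculus[OF x(1)])
         (auto intro!: has_vector_derivative_of_real d0 has_field_derivative_at_within
            simp flip: has_real_derivative_iff_has_vector_derivative)
    then show "complex_of_real (\<phi> x) = complex_of_real (\<phi> p) + integral {p..x} (\<lambda>x. complex_of_real (deriv \<phi> x))"
      by (simp add: integral_unique)
  qed
qed

lemma primitive_integration_by_parts:
  assumes u: "primitive p q v u" and pq: "p \<le> q" and \<phi>: "\<phi> \<in> test_functions p q"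
  shows "integral {p..q} (\<lambda>x. u x * complex_of_real (deriv \<phi> x)) =
    - integral {p..q} (\<lambda>x. v x * complex_of_real (\<phi> x))"
proof -
  note T = test_function_primitive[OF \<phi>]
  obtain B where B: "\<And>x. x \<in> {p..q} \<Longrightarrow> norm (complex_of_real (deriv \<phi> x)) \<le> B"
    using continuous_bounded_Icc[OF T(2)] by metis
  have prod: "primitive p q (\<lambda>x. complex_of_real (deriv \<phi> x) * u x + complex_of_real (\<phi> x) * v x)
      (\<lambda>x. complex_of_real (\<phi> x) * u x)"
    by (rule primitive_mult[OF T(1) u B])
  have "integral {p..q} (\<lambda>x. complex_of_real (deriv \<phi> x) * u x + complex_of_real (\<phi> x) * v x) = 0"
    using primitive_eq[OF prod, of q] T(4,5) pq by simp
  moreover have "(\<lambda>x. complex_of_real (deriv \<phi> x) * u x) integrable_on {p..q}"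
    by (intro integrable_continuous_real continuous_on_mult T(2) primitive_continuous[OF u])
  moreover have "(\<lambda>x. complex_of_real (\<phi> x) * v x) integrable_on {p..q}"
    using abs_int_mult_continuous[OF T(3) primitive_abs_int[OF u]] absolutely_integrable_on_def by blast
  ultimately show ?thesis
    by (simp add: Henstock_Kurzweil_Integration.integral_add mult.commute eq_neg_iff_add_eq_0)
qed

lemma abs_int_mult_bump:
  assumes "g absolutely_integrable_on {p..q}" "bump p q \<psi>"
  shows "(\<lambda>x. g x * complex_of_real (\<psi> x)) absolutely_integrable_on {p..q}"
  using abs_int_mult_continuous[OF continuous_on_of_real[OF bump_continuous[OF assms(2)]] assms(1)]
  by (simp add: mult.commute)

text \<open>
  The bumps \<open>exp (- 1 / (N (x - \<alpha>))) exp (- 1 / (N (\<beta> - x)))\<close> are bounded by 1 and converge to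
  the indicator function of \<open>(\<alpha>, \<beta>)\<close>, so by dominated convergence \<open>g\<close> has integral zero over every
  inner interval.
\<close>

lemma fundamental_lemma_calculus_of_variations:
  fixes g :: "real \<Rightarrow> complex"
  assumes g: "g absolutely_integrable_on {p..q}"
    and zero: "\<And>\<psi>. bump p q \<psi> \<Longrightarrow> integral {p..q} (\<lambda>x. g x * complex_of_real (\<psi> x)) = 0"
  shows "AE x in lebesgue_on {p..q}. g x = 0"
proof (rule AE_zero_if_integrals_zero[OF g])
  have g_int: "g integrable_on {p..q}" using g absolutely_integrable_on_def by blast
  have inner: "integral {\<alpha>..\<beta>} g = 0" if ab: "p < \<alpha>" "\<alpha> < \<beta>" "\<beta> < q" for \<alpha> \<beta>
  proof -
    define \<psi> where "\<psi> n x = flat_exp 0 (real (Suc n) * (x - \<alpha>)) * flat_exp 0 (real (Suc n) * (\<beta> - x))" for n x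
    have b: "bump p q (\<psi> n)" for n
      unfolding \<psi>_def by (rule bump.product) (use ab in auto)
    have bd: "\<bar>\<psi> n x\<bar> \<le> 1" for n x
      unfolding \<psi>_def abs_mult by (rule mult_le_one) (auto simp: flat_exp_def)
    have lim1: "(\<lambda>n. flat_exp 0 (real (Suc n) * y)) \<longlonglongrightarrow> 1" if "y > 0" for y
    proof -
      have "(\<lambda>n. - ((1 / y) * (1 / real (Suc n)))) \<longlonglongrightarrow> - ((1 / y) * 0)"
        by (intro tendsto_minus tendsto_mult_left LIMSEQ_Suc lim_1_over_n)
      then have "(\<lambda>n. exp (- ((1 / y) * (1 / real (Suc n))))) \<longlonglongrightarrow> exp (- ((1 / y) * 0))"
        by (rule tendsto_exp)
      then show ?thesis using that by (simp add: flat_exp_def zero_less_mult_iff mult.commute)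
    qed
    have lim: "(\<lambda>n. g x * complex_of_real (\<psi> n x)) \<longlonglongrightarrow> (if x \<in> {\<alpha><..<\<beta>} then g x else 0)" for x
    proof (cases "x \<in> {\<alpha><..<\<beta>}")
      case True
      then have "(\<lambda>n. \<psi> n x) \<longlonglongrightarrow> 1 * 1"
        unfolding \<psi>_def by (intro tendsto_mult lim1) auto
      then have "(\<lambda>n. g x * complex_of_real (\<psi> n x)) \<longlonglongrightarrow> g x * complex_of_real (1 * 1)"
        by (intro tendsto_mult_left tendsto_of_real)
      then show ?thesis using True by simp
    next
      case False
      then have "\<psi> n x = 0" for n
        by (auto simp: \<psi>_def flat_exp_def zero_less_mult_iff)
      then show ?thesis using False by auto
    qed
    have "(\<lambda>n. integral {p..q} (\<lambda>x. g x * complex_of_real (\<psi> n x))) \<longlonglongrightarrow>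
        integral {p..q} (\<lambda>x. if x \<in> {\<alpha><..<\<beta>} then g x else 0)"
    proof (rule dominated_convergence(2))
      show "(\<lambda>x. g x * complex_of_real (\<psi> n x)) integrable_on {p..q}" for n
        using abs_int_mult_bump[OF g b] absolutely_integrable_on_def by blast
      show "(\<lambda>x. norm (g x)) integrable_on {p..q}"
        using g absolutely_integrable_on_def by blast
      show "norm (g x * complex_of_real (\<psi> n x)) \<le> norm (g x)" for n x
        using mult_left_mono[OF bd[of n x] norm_ge_zero[of "g x"]] by (simp add: norm_mult)
    qed (use lim in auto)
    then have "integral {p..q} (\<lambda>x. if x \<in> {\<alpha><..<\<beta>} then g x else 0) = 0"
      using zero[OF b] by (simp add: LIMSEQ_const_iff)
    also have "integral {p..q} (\<lambda>x. if x \<in> {\<alpha><..<\<beta>} then g x else 0) = integral ({\<alpha><..<\<beta>} \<inter> {p..q}) g"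
      by (rule integral_restrict_Int)
    also have "{\<alpha><..<\<beta>} \<inter> {p..q} = {\<alpha><..<\<beta>}" using ab by auto
    also have "integral {\<alpha><..<\<beta>} g = integral {\<alpha>..\<beta>} g"
      using integral_open_interval_real[of \<alpha> \<beta> g] by simp
    finally show ?thesis .
  qed
  fix x assume x: "p \<le> x" "x \<le> q"
  show "integral {p..x} g = 0"
  proof (cases "p = q")
    case False
    then have pq: "p < q" using x by simp
    define m where "m = (p + q) / 2"
    have m: "p < m" "m < q" using pq by (auto simp: m_def)
    have cont: "continuous_on {p..q} (\<lambda>x. integral {p..x} g)"
      by (rule indefinite_integral_continuous_1[OF g_int])
    have "integral {p..y} g = integral {p..m} g" if "y \<in> {p<..<q}" for y
      using integral_Icc_diff[OF g_int, of y m] integral_Icc_diff[OF g_int, of m y] inner[of y m] inner[of m y] that m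
      by (cases y m rule: linorder_cases) auto
    then have "integral {p..y} g = integral {p..m} g" if "y \<in> {p..q}" for y
      using continuous_constant_on_closure[of "{p<..<q}" "\<lambda>x. integral {p..x} g" "integral {p..m} g" y]
        cont that pq by (simp add: closure_greaterThanLessThan)
    from this[of p] this[of x] show ?thesis using pq x by simp
  qed (use x in auto)
qed

text \<open>
  Subtracting the indefinite integral of \<open>v\<close> leaves a function \<open>g\<close> whose weak derivative is zero,
  that is, one orthogonal to every bump of mean zero. Subtracting from \<open>\<psi>\<close> a multiple of a
  fixed bump \<open>\<psi>\<^sub>0\<close> yields such a bump, so for the right constant \<open>c\<close> the difference
  \<open>g - c\<close> is orthogonal to every bump and vanishes almost everywhere.
\<close>

lemma du_Bois_Reymond:
  assumes pq: "p < q" and u: "u absolutely_integrable_on {p..q}" and v: "v absolutely_integrable_on {p..q}"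
    and weak: "\<And>\<phi>. \<phi> \<in> test_functions p q \<Longrightarrow>
      integral {p..q} (\<lambda>x. u x * complex_of_real (deriv \<phi> x)) =
      - integral {p..q} (\<lambda>x. v x * complex_of_real (\<phi> x))"
  shows "\<exists>w. primitive p q v w \<and> (AE x in lebesgue_on {p..q}. u x = w x)"
proof -
  define W where "W x = integral {p..x} v" for x
  have W: "primitive p q v W" by (rule primitiveI[OF v, of _ 0]) (simp add: W_def)
  define g where "g x = u x - W x" for x
  have g: "g absolutely_integrable_on {p..q}"
    unfolding g_def
    by (intro set_integral_diff(1) u absolutely_integrable_continuous_real primitive_continuous[OF W])
  have g_int: "(\<lambda>x. g x * complex_of_real (\<psi> x)) integrable_on {p..q}" if "bump p q \<psi>" for \<psi>
    using abs_int_mult_bump[OF g that] absolutely_integrable_on_def by blast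
  have orth: "integral {p..q} (\<lambda>x. g x * complex_of_real (\<theta> x)) = 0"
    if chi: "bump p q \<theta>" "integral {p..q} \<theta> = 0" for \<theta>
  proof -
    obtain \<phi> where \<phi>: "\<phi> \<in> test_functions p q" "deriv \<phi> = \<theta>"
      using bump_antiderivative[OF chi] .
    have "(\<lambda>x. W x * complex_of_real (\<theta> x)) absolutely_integrable_on {p..q}"
      "(\<lambda>x. u x * complex_of_real (\<theta> x)) absolutely_integrable_on {p..q}"
      by (intro abs_int_mult_bump chi u absolutely_integrable_continuous_real primitive_continuous[OF W])+
    then have "integral {p..q} (\<lambda>x. g x * complex_of_real (\<theta> x)) =
      integral {p..q} (\<lambda>x. u x * complex_of_real (\<theta> x)) - integral {p..q} (\<lambda>x. W x * complex_of_real (\<theta> x))"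
      unfolding g_def left_diff_distrib absolutely_integrable_on_def
      by (intro Henstock_Kurzweil_Integration.integral_diff) auto
    also have "\<dots> = 0"
      using weak[OF \<phi>(1)] primitive_integration_by_parts[OF W _ \<phi>(1)] pq \<phi>(2) by simp
    finally show ?thesis .
  qed
  define \<alpha> where "\<alpha> = p + (q - p) / 3"
  define \<beta> where "\<beta> = p + 2 * (q - p) / 3"
  have ab: "p < \<alpha>" "\<alpha> < \<beta>" "\<beta> < q" using pq by (auto simp: \<alpha>_def \<beta>_def field_simps)
  define \<psi>\<^sub>0 where "\<psi>\<^sub>0 x = flat_exp 0 (1 * (x - \<alpha>)) * flat_exp 0 (1 * (\<beta> - x))" for x
  have b0: "bump p q \<psi>\<^sub>0"
    unfolding \<psi>\<^sub>0_def by (rule bump.product) (use ab in auto)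
  have nz: "integral {p..q} \<psi>\<^sub>0 \<noteq> 0"
  proof
    assume "integral {p..q} \<psi>\<^sub>0 = 0"
    moreover have "\<psi>\<^sub>0 x \<ge> 0" for x by (simp add: \<psi>\<^sub>0_def flat_exp_def)
    ultimately have "\<forall>x\<in>{p..q}. \<psi>\<^sub>0 x = 0"
      using integral_eq_0_iff[OF bump_continuous[OF b0] pq] by blast
    then have "\<psi>\<^sub>0 ((\<alpha> + \<beta>) / 2) = 0"
      using ab by simp
    then show False using ab by (auto simp: \<psi>\<^sub>0_def flat_exp_def field_simps)
  qed
  \<comment> \<open>The only constant \<open>c\<close> for which \<open>g - c\<close> is orthogonal to \<open>\<psi>\<^sub>0\<close>.\<close>
  define c where "c = integral {p..q} (\<lambda>x. g x * complex_of_real (\<psi>\<^sub>0 x)) / complex_of_real (integral {p..q} \<psi>\<^sub>0)"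
  have "AE x in lebesgue_on {p..q}. g x - c = 0"
  proof (rule fundamental_lemma_calculus_of_variations)
    show "(\<lambda>x. g x - c) absolutely_integrable_on {p..q}"
      by (intro set_integral_diff(1) g absolutely_integrable_continuous_real continuous_intros)
    fix \<psi> assume \<psi>: "bump p q \<psi>"
    define r where "r = integral {p..q} \<psi> / integral {p..q} \<psi>\<^sub>0"
    define \<theta> where "\<theta> x = 1 * \<psi> x + (- r) * \<psi>\<^sub>0 x" for x
    have chi: "bump p q \<theta>" unfolding \<theta>_def by (rule bump.combination[OF \<psi> b0])
    have \<psi>_int: "\<psi> integrable_on {p..q}" "\<psi>\<^sub>0 integrable_on {p..q}"
      by (intro integrable_continuous_real bump_continuous[OF \<psi>] bump_continuous[OF b0])+
    have "integral {p..q} \<theta> = integral {p..q} \<psi> - r * integral {p..q} \<psi>\<^sub>0"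
      unfolding \<theta>_def using \<psi>_int
      by (simp add: Henstock_Kurzweil_Integration.integral_diff integrable_on_mult_right)
    then have "integral {p..q} \<theta> = 0" using nz by (simp add: r_def)
    then have "0 = integral {p..q} (\<lambda>x. g x * complex_of_real (\<theta> x))" using orth chi by simp
    also have "(\<lambda>x. g x * complex_of_real (\<theta> x)) = (\<lambda>x. g x * complex_of_real (\<psi> x) - complex_of_real r * (g x * complex_of_real (\<psi>\<^sub>0 x)))"
      by (auto simp: \<theta>_def algebra_simps)
    also have "integral {p..q} \<dots> = integral {p..q} (\<lambda>x. g x * complex_of_real (\<psi> x))
        - complex_of_real r * integral {p..q} (\<lambda>x. g x * complex_of_real (\<psi>\<^sub>0 x))"
      using g_int[OF \<psi>] g_int[OF b0]
      by (subst Henstock_Kurzweil_Integration.integral_diff) (auto intro: integrable_on_mult_right)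
    also have "complex_of_real r * integral {p..q} (\<lambda>x. g x * complex_of_real (\<psi>\<^sub>0 x)) = c * complex_of_real (integral {p..q} \<psi>)"
      by (simp add: r_def c_def)
    also have "complex_of_real (integral {p..q} \<psi>) = integral {p..q} (\<lambda>x. complex_of_real (\<psi> x))"
      unfolding o_def[symmetric, of complex_of_real \<psi>]
      by (rule integral_linear[OF \<psi>_int(1) bounded_linear_of_real, symmetric])
    finally have eq: "integral {p..q} (\<lambda>x. g x * complex_of_real (\<psi> x)) = c * integral {p..q} (\<lambda>x. complex_of_real (\<psi> x))"
      by simp
    have "integral {p..q} (\<lambda>x. (g x - c) * complex_of_real (\<psi> x)) =
      integral {p..q} (\<lambda>x. g x * complex_of_real (\<psi> x)) - integral {p..q} (\<lambda>x. c * complex_of_real (\<psi> x))"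
      unfolding left_diff_distrib
      by (intro Henstock_Kurzweil_Integration.integral_diff g_int \<psi> integrable_continuous_real continuous_intros bump_continuous[OF \<psi>])
    then show "integral {p..q} (\<lambda>x. (g x - c) * complex_of_real (\<psi> x)) = 0"
      using eq by simp
  qed
  then have "AE x in lebesgue_on {p..q}. u x = c + W x"
    by eventually_elim (simp add: g_def algebra_simps)
  moreover have "primitive p q v (\<lambda>x. c + W x)"
    by (rule primitiveI[OF v, of _ c]) (simp add: W_def)
  ultimately show ?thesis by blast
qed

section \<open>Square-integrable classes and their weak derivatives\<close>

lemma l2_class_iff:
  "h \<in> l2_class M f \<longleftrightarrow> f \<in> l2_fun M \<and> h \<in> l2_fun M \<and> (AE x in M. f x = h x)"
  by (auto simp: l2_class_def l2_rel_def)

lemma l2_class_self: "f \<in> l2_fun M \<Longrightarrow> f \<in> l2_class M f"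
  by (simp add: l2_class_iff)

lemma l2_class_eqI:
  assumes "f \<in> l2_fun M" "g \<in> l2_fun M" "AE x in M. f x = g x"
  shows "l2_class M f = l2_class M g"
proof (rule set_eqI)
  fix h
  have "(AE x in M. f x = h x) \<longleftrightarrow> (AE x in M. g x = h x)"
    using assms(3) by (intro iffI; elim AE_mp) (auto elim!: eventually_mono)
  then show "h \<in> l2_class M f \<longleftrightarrow> h \<in> l2_class M g"
    using assms by (auto simp: l2_class_iff)
qed

lemma l2_class_eqD:
  assumes "f \<in> l2_fun M" "l2_class M f = l2_class M g"
  shows "AE x in M. f x = g x"
  using l2_class_self[OF assms(1)] assms(2) by (auto simp: l2_class_iff elim: eventually_mono)

lemma L2_iff: "F \<in> L2 I \<longleftrightarrow> (\<exists>f\<in>l2_fun (lebesgue_on I). F = l2_class (lebesgue_on I) f)"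
  by (auto simp: L2_def quotient_def l2_class_def)

lemma L2_classI: "f \<in> l2_fun (lebesgue_on I) \<Longrightarrow> l2_class (lebesgue_on I) f \<in> L2 I"
  by (auto simp: L2_iff)

lemma l2_fun_measurable: "f \<in> l2_fun M \<Longrightarrow> f \<in> borel_measurable M"
  by (simp add: l2_fun_def)

lemma l2_fun_add:
  assumes "f \<in> l2_fun M" "g \<in> l2_fun M"
  shows "(\<lambda>x. f x + g x) \<in> l2_fun M"
proof -
  have [measurable]: "f \<in> borel_measurable M" "g \<in> borel_measurable M"
    using assms by (auto simp: l2_fun_def)
  have "integrable M (\<lambda>x. (norm (f x + g x))\<^sup>2)"
  proof (rule Bochner_Integration.integrable_bound)
    show "integrable M (\<lambda>x. 2 * (norm (f x))\<^sup>2 + 2 * (norm (g x))\<^sup>2)"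
      using assms by (auto simp: l2_fun_def)
    have "(norm (f x + g x))\<^sup>2 \<le> 2 * (norm (f x))\<^sup>2 + 2 * (norm (g x))\<^sup>2" for x
    proof -
      have "(norm (f x + g x))\<^sup>2 \<le> (norm (f x) + norm (g x))\<^sup>2"
        by (intro power_mono norm_triangle_ineq) auto
      also have "\<dots> \<le> 2 * (norm (f x))\<^sup>2 + 2 * (norm (g x))\<^sup>2"
        using sum_squares_bound[of "norm (f x)" "norm (g x)"] by (simp add: power2_sum)
      finally show ?thesis .
    qed
    then show "AE x in M. norm ((norm (f x + g x))\<^sup>2) \<le> norm (2 * (norm (f x))\<^sup>2 + 2 * (norm (g x))\<^sup>2)"
      by (intro AE_I2) (auto simp: abs_of_nonneg)
  qed measurable
  then show ?thesis by (simp add: l2_fun_def)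
qed

lemma l2_fun_mult:
  assumes "f \<in> l2_fun M" "m \<in> borel_measurable M" "\<And>x. x \<in> space M \<Longrightarrow> norm (m x) \<le> C"
  shows "(\<lambda>x. m x * f x) \<in> l2_fun M"
proof -
  have [measurable]: "f \<in> borel_measurable M" "m \<in> borel_measurable M"
    using assms by (auto simp: l2_fun_def)
  have "integrable M (\<lambda>x. (norm (m x * f x))\<^sup>2)"
  proof (rule Bochner_Integration.integrable_bound)
    show "integrable M (\<lambda>x. C\<^sup>2 * (norm (f x))\<^sup>2)"
      using assms by (auto simp: l2_fun_def)
    have "(norm (m x * f x))\<^sup>2 \<le> C\<^sup>2 * (norm (f x))\<^sup>2" if "x \<in> space M" for x
      unfolding norm_mult power_mult_distrib
      by (intro mult_right_mono power_mono assms(3) that) auto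
    then show "AE x in M. norm ((norm (m x * f x))\<^sup>2) \<le> norm (C\<^sup>2 * (norm (f x))\<^sup>2)"
      by (intro AE_I2) (auto simp: abs_of_nonneg)
  qed measurable
  then show ?thesis by (simp add: l2_fun_def)
qed

lemma l2_fun_cmult: "f \<in> l2_fun M \<Longrightarrow> (\<lambda>x. c * f x) \<in> l2_fun M"
  using l2_fun_mult[of f M "\<lambda>_. c" "norm c"] by simp

lemma l2_fun_bounded:
  assumes "f \<in> borel_measurable (lebesgue_on {p..q})" "\<And>x. x \<in> {p..q} \<Longrightarrow> norm (f x) \<le> C"
  shows "f \<in> l2_fun (lebesgue_on {p..q})"
proof -
  interpret finite_measure "lebesgue_on {p..q}" by (rule finite_measure_lebesgue_on) simp
  have "(\<lambda>_. 1) \<in> l2_fun (lebesgue_on {p..q})" by (simp add: l2_fun_def)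
  from l2_fun_mult[OF this assms(1)] assms(2) show ?thesis by auto
qed

lemma l2_fun_continuous:
  assumes "continuous_on {p..q} f"
  shows "f \<in> l2_fun (lebesgue_on {p..q})"
  using continuous_bounded_Icc[OF assms] l2_fun_bounded[OF continuous_measurable_Icc[OF assms]] by metis

lemma l2_fun_abs_int:
  assumes "f \<in> l2_fun (lebesgue_on {p..q})"
  shows "f absolutely_integrable_on {p..q}"
proof -
  interpret finite_measure "lebesgue_on {p..q}" by (rule finite_measure_lebesgue_on) simp
  have "integrable (lebesgue_on {p..q}) f"
  proof (rule Bochner_Integration.integrable_bound)
    show "integrable (lebesgue_on {p..q}) (\<lambda>x. 1 + (norm (f x))\<^sup>2)"
      using assms by (auto simp: l2_fun_def)
    have "norm (f x) \<le> 1 + (norm (f x))\<^sup>2" for x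
      using sum_squares_bound[of 1 "norm (f x)"] norm_ge_zero[of "f x"]
      unfolding one_power2 mult_1_right by linarith
    then show "AE x in lebesgue_on {p..q}. norm (f x) \<le> norm (1 + (norm (f x))\<^sup>2)"
      by (intro AE_I2) (auto simp: abs_of_nonneg)
  qed (use assms in \<open>simp add: l2_fun_def\<close>)
  then show ?thesis
    unfolding set_integrable_def by (subst (asm) integrable_restrict_space) auto
qed

lemma l2_fun_subset:
  assumes "f \<in> l2_fun (lebesgue_on I)" "J \<subseteq> I" "I \<in> sets lebesgue" "J \<in> sets lebesgue"
  shows "f \<in> l2_fun (lebesgue_on J)"
proof -
  have "(\<lambda>x. (norm (f x))\<^sup>2) absolutely_integrable_on I"
    using assms unfolding set_integrable_def l2_fun_def by (auto simp: integrable_restrict_space)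
  then have "(\<lambda>x. (norm (f x))\<^sup>2) absolutely_integrable_on J"
    by (rule set_integrable_subset) (use assms in auto)
  then have "integrable (lebesgue_on J) (\<lambda>x. (norm (f x))\<^sup>2)"
    using assms(4) by (rule absolutely_integrable_imp_integrable)
  moreover have "f \<in> borel_measurable (lebesgue_on J)"
    by (rule measurable_restrict_mono[OF l2_fun_measurable[OF assms(1)] assms(2)])
  ultimately show ?thesis by (simp add: l2_fun_def)
qed

lemma AE_lebesgue_on_subset:
  assumes "AE x in lebesgue_on I. P x" "J \<subseteq> I" "I \<in> sets lebesgue" "J \<in> sets lebesgue"
  shows "AE x in lebesgue_on J. P x"
proof -
  have "AE x in lebesgue. x \<in> I \<longrightarrow> P x"
    using assms(1,3) by (subst (asm) AE_restrict_space_iff) auto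
  then have "AE x in lebesgue. x \<in> J \<longrightarrow> P x"
    by eventually_elim (use assms(2) in auto)
  then show ?thesis using assms(4) by (subst AE_restrict_space_iff) auto
qed

lemma l2_add_class:
  assumes "f \<in> l2_fun (lebesgue_on I)" "g \<in> l2_fun (lebesgue_on I)"
  shows "l2_add I (l2_class (lebesgue_on I) f) (l2_class (lebesgue_on I) g) =
    l2_class (lebesgue_on I) (\<lambda>x. f x + g x)"
proof -
  have "l2_class (lebesgue_on I) (\<lambda>x. f' x + g' x) = l2_class (lebesgue_on I) (\<lambda>x. f x + g x)"
    if "f' \<in> l2_class (lebesgue_on I) f" "g' \<in> l2_class (lebesgue_on I) g" for f' g'
  proof (rule l2_class_eqI)
    have "AE x in lebesgue_on I. f x = f' x" "AE x in lebesgue_on I. g x = g' x"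
      using that by (auto simp: l2_class_iff)
    then show "AE x in lebesgue_on I. f' x + g' x = f x + g x" by eventually_elim simp
  qed (use that assms in \<open>auto simp: l2_class_iff intro: l2_fun_add\<close>)
  then show ?thesis
    unfolding l2_add_def using l2_class_self[OF assms(1)] l2_class_self[OF assms(2)] by blast
qed

lemma l2_fun_cong_AE:
  assumes "f \<in> l2_fun M" "g \<in> borel_measurable M" "AE x in M. f x = g x"
  shows "g \<in> l2_fun M"
proof -
  have [measurable]: "f \<in> borel_measurable M" "g \<in> borel_measurable M"
    using assms by (auto simp: l2_fun_def)
  have "integrable M (\<lambda>x. (norm (f x))\<^sup>2) \<longleftrightarrow> integrable M (\<lambda>x. (norm (g x))\<^sup>2)"
  proof (rule integrable_cong_AE)
    show "AE x in M. (norm (f x))\<^sup>2 = (norm (g x))\<^sup>2"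
      using assms(3) by eventually_elim simp
  qed measurable
  then show ?thesis using assms by (simp add: l2_fun_def)
qed

text \<open>
  Allowing the multiplier \<open>m'\<close> to be bounded only almost everywhere lets \<open>a\<close> be replaced by a
  truncation \<open>m\<close> whose bound holds at every point.
\<close>

lemma l2_mult_class:
  assumes f: "f \<in> l2_fun (lebesgue_on I)" and m: "m \<in> borel_measurable (lebesgue_on I)"
    "\<And>x. x \<in> I \<Longrightarrow> norm (m x) \<le> C"
    and m': "m' \<in> borel_measurable (lebesgue_on I)" "AE x in lebesgue_on I. m x = m' x"
  shows "l2_mult I m' (l2_class (lebesgue_on I) f) = l2_class (lebesgue_on I) (\<lambda>x. m x * f x)"
proof -
  have mf: "(\<lambda>x. m x * f x) \<in> l2_fun (lebesgue_on I)"
    by (rule l2_fun_mult[OF f m(1), of C]) (use m(2) in auto)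
  have "l2_class (lebesgue_on I) (\<lambda>x. m' x * f' x) = l2_class (lebesgue_on I) (\<lambda>x. m x * f x)"
    if f': "f' \<in> l2_class (lebesgue_on I) f" for f'
  proof -
    have [measurable]: "f' \<in> borel_measurable (lebesgue_on I)" "m' \<in> borel_measurable (lebesgue_on I)"
      using f' m' by (auto simp: l2_class_iff l2_fun_def)
    have "AE x in lebesgue_on I. f x = f' x" using f' by (simp add: l2_class_iff)
    then have AE: "AE x in lebesgue_on I. m x * f x = m' x * f' x"
      using m'(2) by eventually_elim simp
    have "(\<lambda>x. m' x * f' x) \<in> l2_fun (lebesgue_on I)"
      by (rule l2_fun_cong_AE[OF mf _ AE]) measurable
    then show ?thesis using l2_class_eqI[OF mf _ AE] by simp
  qed
  then show ?thesis
    unfolding l2_mult_def using l2_class_self[OF f] by blast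
qed

lemma l2_restrict_class:
  assumes "f \<in> l2_fun (lebesgue_on I)" "J \<subseteq> I" "I \<in> sets lebesgue" "J \<in> sets lebesgue"
  shows "l2_restrict J (l2_class (lebesgue_on I) f) = l2_class (lebesgue_on J) f"
proof -
  have "l2_class (lebesgue_on J) f' = l2_class (lebesgue_on J) f"
    if "f' \<in> l2_class (lebesgue_on I) f" for f'
  proof (rule l2_class_eqI)
    have "AE x in lebesgue_on I. f' x = f x"
      using that by (auto simp: l2_class_iff elim: eventually_mono)
    then show "AE x in lebesgue_on J. f' x = f x"
      by (rule AE_lebesgue_on_subset) fact+
  qed (use that assms in \<open>auto simp: l2_class_iff intro: l2_fun_subset\<close>)
  then show ?thesis
    unfolding l2_restrict_def using l2_class_self[OF assms(1)] by blast
qed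

lemma continuous_AE_eq_imp_eq:
  fixes f g :: "real \<Rightarrow> complex"
  assumes "p < q" "continuous_on {p..q} f" "continuous_on {p..q} g"
    "AE x in lebesgue_on {p..q}. f x = g x" "x \<in> {p..q}"
  shows "f x = g x"
proof -
  let ?h = "\<lambda>x. norm (f x - g x)"
  have cont: "continuous_on {p..q} ?h" by (intro continuous_intros assms)
  have "integrable (lebesgue_on {p..q}) ?h"
    by (rule absolutely_integrable_imp_integrable[OF absolutely_integrable_continuous_real[OF cont]]) simp
  then have "integral {p..q} ?h = (LINT x|lebesgue_on {p..q}. ?h x)"
    by (rule lebesgue_integral_eq_integral[symmetric]) simp
  also have "\<dots> = 0"
    by (rule integral_eq_zero_AE) (use assms(4) in eventually_elim, simp)
  finally have "\<forall>x\<in>{p..q}. ?h x = 0"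
    using integral_eq_0_iff[OF cont assms(1)] by simp
  then show ?thesis using assms(5) by auto
qed

lemma LINT_eq_integral_l2_continuous:
  assumes "u \<in> l2_fun (lebesgue_on {p..q})" "continuous_on {p..q} \<psi>"
  shows "(LINT x|lebesgue_on {p..q}. u x * \<psi> x) = integral {p..q} (\<lambda>x. u x * \<psi> x)"
proof -
  have "(\<lambda>x. u x * \<psi> x) absolutely_integrable_on {p..q}"
    using abs_int_mult_continuous[OF assms(2) l2_fun_abs_int[OF assms(1)]] by (simp add: mult.commute)
  then have "integrable (lebesgue_on {p..q}) (\<lambda>x. u x * \<psi> x)"
    by (rule absolutely_integrable_imp_integrable) simp
  then show ?thesis by (rule lebesgue_integral_eq_integral) simp
qed

lemma is_weak_deriv_primitive:
  assumes pq: "p < q" and w: "primitive p q v w" and v: "v \<in> l2_fun (lebesgue_on {p..q})"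
  shows "is_weak_deriv p q (l2_class (lebesgue_on {p..q}) w) (l2_class (lebesgue_on {p..q}) v)"
  unfolding is_weak_deriv_def
proof (intro ballI)
  fix u' v' \<phi>
  assume u': "u' \<in> l2_class (lebesgue_on {p..q}) w" and v': "v' \<in> l2_class (lebesgue_on {p..q}) v"
    and \<phi>: "\<phi> \<in> test_functions p q"
  note T = test_function_primitive[OF \<phi>]
  have w_l2: "w \<in> l2_fun (lebesgue_on {p..q})" using u' by (simp add: l2_class_iff)
  have m[measurable]: "u' \<in> borel_measurable (lebesgue_on {p..q})" "w \<in> borel_measurable (lebesgue_on {p..q})"
    "v' \<in> borel_measurable (lebesgue_on {p..q})" "v \<in> borel_measurable (lebesgue_on {p..q})"
    "(\<lambda>x. complex_of_real (deriv \<phi> x)) \<in> borel_measurable (lebesgue_on {p..q})"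
    "(\<lambda>x. complex_of_real (\<phi> x)) \<in> borel_measurable (lebesgue_on {p..q})"
    using u' v' T(2,3) by (auto simp only: l2_class_iff l2_fun_def continuous_measurable_Icc)
  have "(LINT x|lebesgue_on {p..q}. u' x * complex_of_real (deriv \<phi> x)) =
      (LINT x|lebesgue_on {p..q}. w x * complex_of_real (deriv \<phi> x))"
  proof (rule integral_cong_AE)
    have "AE x in lebesgue_on {p..q}. w x = u' x" using u' by (simp add: l2_class_iff)
    then show "AE x in lebesgue_on {p..q}. u' x * complex_of_real (deriv \<phi> x) = w x * complex_of_real (deriv \<phi> x)"
      by eventually_elim simp
  qed measurable
  also have "\<dots> = integral {p..q} (\<lambda>x. w x * complex_of_real (deriv \<phi> x))"
    by (rule LINT_eq_integral_l2_continuous[OF w_l2 T(2)])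
  also have "\<dots> = - integral {p..q} (\<lambda>x. v x * complex_of_real (\<phi> x))"
    using primitive_integration_by_parts[OF w _ \<phi>] pq by simp
  also have "integral {p..q} (\<lambda>x. v x * complex_of_real (\<phi> x)) =
      (LINT x|lebesgue_on {p..q}. v x * complex_of_real (\<phi> x))"
    by (rule LINT_eq_integral_l2_continuous[OF v T(3), symmetric])
  also have "\<dots> = (LINT x|lebesgue_on {p..q}. v' x * complex_of_real (\<phi> x))"
  proof (rule integral_cong_AE)
    have "AE x in lebesgue_on {p..q}. v x = v' x" using v' by (simp add: l2_class_iff)
    then show "AE x in lebesgue_on {p..q}. v x * complex_of_real (\<phi> x) = v' x * complex_of_real (\<phi> x)"
      by eventually_elim simp
  qed measurable
  finally show "(LINT x|lebesgue_on {p..q}. u' x * complex_of_real (deriv \<phi> x)) =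
      - (LINT x|lebesgue_on {p..q}. v' x * complex_of_real (\<phi> x))" .
qed

lemma is_weak_deriv_obtain_primitive:
  assumes pq: "p < q" and U: "U \<in> L2 {p..q}" and V: "V \<in> L2 {p..q}" and weak: "is_weak_deriv p q U V"
  obtains v w where "primitive p q v w" "v \<in> l2_fun (lebesgue_on {p..q})"
    "U = l2_class (lebesgue_on {p..q}) w" "V = l2_class (lebesgue_on {p..q}) v"
proof -
  obtain u v where u: "u \<in> l2_fun (lebesgue_on {p..q})" "U = l2_class (lebesgue_on {p..q}) u"
    and v: "v \<in> l2_fun (lebesgue_on {p..q})" "V = l2_class (lebesgue_on {p..q}) v"
    using U V by (auto simp: L2_iff)
  have "\<exists>w. primitive p q v w \<and> (AE x in lebesgue_on {p..q}. u x = w x)"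
  proof (rule du_Bois_Reymond[OF pq l2_fun_abs_int[OF u(1)] l2_fun_abs_int[OF v(1)]])
    fix \<phi> assume \<phi>: "\<phi> \<in> test_functions p q"
    note T = test_function_primitive[OF \<phi>]
    have "u \<in> U" "v \<in> V" using u v by (auto intro: l2_class_self)
    then have "(LINT x|lebesgue_on {p..q}. u x * complex_of_real (deriv \<phi> x)) =
      - (LINT x|lebesgue_on {p..q}. v x * complex_of_real (\<phi> x))"
      using weak \<phi> unfolding is_weak_deriv_def by blast
    then show "integral {p..q} (\<lambda>x. u x * complex_of_real (deriv \<phi> x)) =
      - integral {p..q} (\<lambda>x. v x * complex_of_real (\<phi> x))"
      using LINT_eq_integral_l2_continuous[OF u(1) T(2)] LINT_eq_integral_l2_continuous[OF v(1) T(3)] by simp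
  qed
  then obtain w where w: "primitive p q v w" "AE x in lebesgue_on {p..q}. u x = w x" by blast
  have "U = l2_class (lebesgue_on {p..q}) w"
    unfolding u(2) by (rule l2_class_eqI[OF u(1) l2_fun_continuous[OF primitive_continuous[OF w(1)]] w(2)])
  then show ?thesis using that w v by blast
qed

lemma primitive_AE_unique:
  assumes pq: "p < q" and w: "primitive p q v w" "primitive p q v' w'"
    and AE: "AE x in lebesgue_on {p..q}. w x = w' x"
  shows "AE x in lebesgue_on {p..q}. v x = v' x"
proof -
  have eq: "w x = w' x" if "x \<in> {p..q}" for x
    by (rule continuous_AE_eq_imp_eq[OF pq primitive_continuous[OF w(1)] primitive_continuous[OF w(2)] AE that])
  have "AE x in lebesgue_on {p..q}. v x - v' x = 0"
  proof (rule AE_zero_if_integrals_zero)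
    show "(\<lambda>x. v x - v' x) absolutely_integrable_on {p..q}"
      by (intro set_integral_diff(1) primitive_abs_int[OF w(1)] primitive_abs_int[OF w(2)])
    fix x assume x: "p \<le> x" "x \<le> q"
    have "v integrable_on {p..x}" "v' integrable_on {p..x}"
      using primitive_integrable[OF primitive_subinterval[OF w(1), of p x]]
        primitive_integrable[OF primitive_subinterval[OF w(2), of p x]] x by auto
    then have "integral {p..x} (\<lambda>x. v x - v' x) = integral {p..x} v - integral {p..x} v'"
      by (rule Henstock_Kurzweil_Integration.integral_diff)
    then show "integral {p..x} (\<lambda>x. v x - v' x) = 0"
      using primitive_eq[OF w(1) x] primitive_eq[OF w(2) x] eq[of x] eq[of p] x by simp
  qed
  then show ?thesis by eventually_elim simp
qed

text \<open>
  Weak derivatives and continuous representatives, which are given by definite descriptions, become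
  computable once a class is presented by an indefinite integral.
\<close>

lemma sobolev_primitive:
  assumes pq: "p < q" and w: "primitive p q v w" and v: "v \<in> l2_fun (lebesgue_on {p..q})"
  shows "l2_class (lebesgue_on {p..q}) w \<in> sobolev p q"
    and "weak_deriv p q (l2_class (lebesgue_on {p..q}) w) = l2_class (lebesgue_on {p..q}) v"
    and "x \<in> {p..q} \<Longrightarrow> cont_value p q (l2_class (lebesgue_on {p..q}) w) x = w x"
proof -
  let ?W = "l2_class (lebesgue_on {p..q}) w" and ?V = "l2_class (lebesgue_on {p..q}) v"
  have w_l2: "w \<in> l2_fun (lebesgue_on {p..q})"
    by (rule l2_fun_continuous[OF primitive_continuous[OF w]])
  note weak = is_weak_deriv_primitive[OF pq w v]
  show "?W \<in> sobolev p q"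
    unfolding sobolev_def using weak L2_classI[OF w_l2] L2_classI[OF v] by blast
  show "weak_deriv p q ?W = ?V"
    unfolding weak_deriv_def
  proof (rule the_equality)
    show "?V \<in> L2 {p..q} \<and> is_weak_deriv p q ?W ?V" using weak L2_classI[OF v] by blast
    fix V assume V: "V \<in> L2 {p..q} \<and> is_weak_deriv p q ?W V"
    obtain v' w' where *: "primitive p q v' w'" "v' \<in> l2_fun (lebesgue_on {p..q})"
      "?W = l2_class (lebesgue_on {p..q}) w'" "V = l2_class (lebesgue_on {p..q}) v'"
      using is_weak_deriv_obtain_primitive[OF pq L2_classI[OF w_l2]] V by metis
    have "AE x in lebesgue_on {p..q}. v' x = v x"
      using primitive_AE_unique[OF pq w *(1) l2_class_eqD[OF w_l2 *(3)]] by (auto elim: eventually_mono)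
    then show "V = ?V" unfolding *(4) by (intro l2_class_eqI * v)
  qed
  show "cont_value p q ?W x = w x" if "x \<in> {p..q}"
    unfolding cont_value_def
  proof (rule the_equality)
    show "\<exists>u\<in>?W. continuous_on {p..q} u \<and> u x = w x"
      using l2_class_self[OF w_l2] primitive_continuous[OF w] by blast
    fix z assume "\<exists>u\<in>?W. continuous_on {p..q} u \<and> u x = z"
    then obtain u where u: "u \<in> ?W" "continuous_on {p..q} u" "u x = z" by blast
    then show "z = w x"
      using continuous_AE_eq_imp_eq[OF pq primitive_continuous[OF w] u(2) _ that] by (simp add: l2_class_iff)
  qed
qed

section \<open>The resolvent on the pieces of a partition\<close>

lemma partition_mono:
  assumes "is_partition L n t" "i \<le> j" "j \<le> n"
  shows "t i \<le> t j"
  using assms(2,3)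
proof (induction rule: dec_induct)
  case (step m)
  then have "t m < t (Suc m)" using assms(1) by (simp add: is_partition_def)
  then show ?case using step by simp
qed simp

text \<open>
  What the nice structure of \<open>A\<close> amounts to on the pieces of the partition: \<open>A\<close> has density \<open>a\<close>
  between partition points, the last piece including its end point. The function \<open>b\<close> is a
  representative of \<open>a\<close> bounded at every point, as the product rule for indefinite integrals
  requires.
\<close>

locale piecewise_phase =
  fixes L :: real and A a b :: "real \<Rightarrow> real" and C :: real and n :: nat and t :: "nat \<Rightarrow> real"
  assumes L_pos: "L > 0"
    and partition: "is_partition L n t"
    and A_0: "A 0 = 0"
    and A_measurable: "A \<in> borel_measurable (lebesgue_on {0..L})"
    and a_measurable: "a \<in> borel_measurable (lebesgue_on {0..L})"
    and b_measurable: "b \<in> borel_measurable (lebesgue_on {0..L})"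
    and b_eq_a: "AE x in lebesgue_on {0..L}. b x = a x"
    and b_bound: "\<And>x. x \<in> {0..L} \<Longrightarrow> \<bar>b x\<bar> \<le> C"
    and A_piece: "\<And>k x. k \<in> {1..n} \<Longrightarrow> t (k - 1) \<le> x \<Longrightarrow> x < t k \<Longrightarrow>
        A x = A (t (k - 1)) + integral {t (k - 1)..x} b"
    and A_end: "A L = A (t (n - 1)) + integral {t (n - 1)..L} b"
begin

lemma n_pos: "n \<ge> 1" and t_0: "t 0 = 0" and t_n: "t n = L"
  using partition by (auto simp: is_partition_def)

lemma t_step: "k \<in> {1..n} \<Longrightarrow> t (k - 1) < t k"
  using partition unfolding is_partition_def
  by (metis One_nat_def Suc_pred atLeastAtMost_iff less_eq_Suc_le)

lemmas t_mono = partition_mono[OF partition]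

lemma piece_subset:
  assumes "k \<in> {1..n}"
  shows "0 \<le> t (k - 1)" "t k \<le> L" "{t (k - 1)..t k} \<subseteq> {0..L}"
  using t_mono[of 0 "k - 1"] t_mono[of k n] assms t_0 t_n by auto

lemma piece_l2: "f \<in> l2_fun (lebesgue_on {0..L}) \<Longrightarrow> k \<in> {1..n} \<Longrightarrow>
    f \<in> l2_fun (lebesgue_on {t (k - 1)..t k})"
  by (rule l2_fun_subset[OF _ piece_subset(3)]) auto

lemma piece_measurable: "f \<in> borel_measurable (lebesgue_on {0..L}) \<Longrightarrow> k \<in> {1..n} \<Longrightarrow>
    f \<in> borel_measurable (lebesgue_on {t (k - 1)..t k})"
  by (rule measurable_restrict_mono[OF _ piece_subset(3)])

lemma piece_exists:
  assumes "x \<in> {0..<L}"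
  shows "\<exists>k\<in>{1..n}. t (k - 1) \<le> x \<and> x < t k"
proof -
  define k where "k = (LEAST k. x < t k)"
  have ex: "x < t n" using assms t_n by simp
  have k: "x < t k" "k \<le> n" unfolding k_def using ex by (auto intro: LeastI Least_le)
  have "k \<noteq> 0" using k(1) assms t_0 by (cases k) auto
  then have "\<not> x < t (k - 1)" unfolding k_def by (intro not_less_Least) (auto simp: k_def[symmetric])
  then show ?thesis using k \<open>k \<noteq> 0\<close> by (intro bexI[of _ k]) auto
qed

lemma piece_unique:
  assumes "k \<in> {1..n}" "j \<in> {1..n}" "t (k - 1) \<le> x" "x < t k" "t (j - 1) \<le> x" "x < t j"
  shows "j = k"
proof (cases j k rule: linorder_cases)
  case less
  then have "t j \<le> t (k - 1)" using assms by (intro t_mono) auto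
  then show ?thesis using assms by simp
next
  case greater
  then have "t k \<le> t (j - 1)" using assms by (intro t_mono) auto
  then show ?thesis using assms by simp
qed

text \<open>
  The continuous extension to the closed piece: at the right end point it takes the left limit of
  \<open>A\<close> instead of its value, and the jump is the difference of the two (\<open>jump_eq\<close>).
\<close>

definition piece_A :: "nat \<Rightarrow> real \<Rightarrow> real" where
  "piece_A k x = A (t (k - 1)) + integral {t (k - 1)..x} b"

definition piece_exp :: "nat \<Rightarrow> real \<Rightarrow> complex" where
  "piece_exp k x = exp (\<i> * complex_of_real (piece_A k x) - complex_of_real x)"

lemma A_eq_piece_A: "k \<in> {1..n} \<Longrightarrow> t (k - 1) \<le> x \<Longrightarrow> x < t k \<Longrightarrow> A x = piece_A k x"
  unfolding piece_A_def by (rule A_piece)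

lemma A_eq_piece_A_end: "A L = piece_A n L"
  unfolding piece_A_def by (rule A_end)

lemma b_int:
  assumes "k \<in> {1..n}"
  shows "b integrable_on {t (k - 1)..t k}"
proof -
  have "b absolutely_integrable_on {t (k - 1)..t k}"
    by (rule measurable_bounded_by_integrable_imp_absolutely_integrable[OF piece_measurable[OF b_measurable assms],
        where g = "\<lambda>_. C"])
      (use b_bound piece_subset[OF assms] in auto)
  then show ?thesis by (simp add: absolutely_integrable_on_def)
qed

lemma piece_A_continuous:
  assumes "k \<in> {1..n}"
  shows "continuous_on {t (k - 1)..t k} (piece_A k)"
  unfolding piece_A_def by (intro continuous_intros indefinite_integral_continuous_1 b_int assms)

lemma jump_eq:
  assumes j: "j \<in> {1..<n}"
  shows "jump A (t j) = A (t j) - piece_A j (t j)"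
proof -
  have j1: "j \<in> {1..n}" and j2: "Suc j \<in> {1..n}" using j by auto
  have lt: "t (j - 1) < t j" "t j < t (Suc j)" using t_step[OF j1] t_step[OF j2] by auto
  have "(piece_A j \<longlongrightarrow> piece_A j (t j)) (at_left (t j))"
    using piece_A_continuous[OF j1] lt(1)
    by (metis at_within_Icc_at_left atLeastAtMost_iff continuous_on order_less_imp_le order_refl)
  moreover have "eventually (\<lambda>x. piece_A j x = A x) (at_left (t j))"
    unfolding eventually_at_left_field using A_eq_piece_A[OF j1] lt by (intro exI[of _ "t (j - 1)"]) auto
  ultimately have left: "(A \<longlongrightarrow> piece_A j (t j)) (at_left (t j))" by (rule Lim_transform_eventually)
  have "(piece_A (Suc j) \<longlongrightarrow> piece_A (Suc j) (t j)) (at_right (t j))"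
    using piece_A_continuous[OF j2] lt(2)
    by (metis at_within_Icc_at_right atLeastAtMost_iff continuous_on order_less_imp_le order_refl diff_Suc_1)
  moreover have "eventually (\<lambda>x. piece_A (Suc j) x = A x) (at_right (t j))"
    unfolding eventually_at_right_field using A_eq_piece_A[OF j2] lt by (intro exI[of _ "t (Suc j)"]) auto
  ultimately have "(A \<longlongrightarrow> piece_A (Suc j) (t j)) (at_right (t j))" by (rule Lim_transform_eventually)
  moreover have "piece_A (Suc j) (t j) = A (t j)" by (simp add: piece_A_def)
  ultimately have right: "(A \<longlongrightarrow> A (t j)) (at_right (t j))" by simp
  show ?thesis
    unfolding jump_def using tendsto_Lim[OF _ left] tendsto_Lim[OF _ right] by simp
qed

lemma piece_exp_nonzero: "piece_exp k x \<noteq> 0"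
  by (simp add: piece_exp_def)

lemma piece_exp_junction:
  assumes "j \<in> {1..<n}"
  shows "piece_exp (Suc j) (t j) * exp (- \<i> * complex_of_real (jump A (t j))) = piece_exp j (t j)"
proof -
  have "piece_A (Suc j) (t j) = A (t j)" by (simp add: piece_A_def)
  then show ?thesis
    unfolding piece_exp_def jump_eq[OF assms] exp_add[symmetric] by (simp add: algebra_simps)
qed

lemma piece_exp_eq_exp_Phi:
  assumes "k \<in> {1..n}" "t (k - 1) \<le> x" "x < t k \<or> x = L \<and> k = n"
  shows "piece_exp k x = exp (Phi A x)"
  using A_eq_piece_A[OF assms(1,2)] A_eq_piece_A_end assms(3) by (auto simp: piece_exp_def Phi_def)

lemma piece_exponent_primitive:
  assumes k: "k \<in> {1..n}"
  shows "primitive (t (k - 1)) (t k) (\<lambda>x. \<i> * complex_of_real (b x) - 1)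
    (\<lambda>x. \<i> * complex_of_real (piece_A k x) - complex_of_real x)"
proof (rule primitiveI[where c = "\<i> * complex_of_real (A (t (k - 1))) - complex_of_real (t (k - 1))"])
  note bm = piece_measurable[OF b_measurable k]
  show "(\<lambda>x. \<i> * complex_of_real (b x) - 1) absolutely_integrable_on {t (k - 1)..t k}"
  proof (rule l2_fun_abs_int[OF l2_fun_bounded])
    show "(\<lambda>x. \<i> * complex_of_real (b x) - 1) \<in> borel_measurable (lebesgue_on {t (k - 1)..t k})"
      using bm by measurable
    show "norm (\<i> * complex_of_real (b x) - 1) \<le> C + 1" if "x \<in> {t (k - 1)..t k}" for x
      using norm_triangle_ineq4[of "\<i> * complex_of_real (b x)" 1] b_bound[of x] piece_subset[OF k] that
      by (auto simp: norm_mult)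
  qed
  fix x assume x: "t (k - 1) \<le> x" "x \<le> t k"
  have bi: "b integrable_on {t (k - 1)..x}"
    by (rule integrable_on_subinterval[OF b_int[OF k]]) (use x in auto)
  have cb: "integral {t (k - 1)..x} (\<lambda>s. complex_of_real (b s)) = complex_of_real (integral {t (k - 1)..x} b)"
    unfolding o_def[symmetric, of complex_of_real b]
    by (rule integral_linear[OF bi bounded_linear_of_real])
  have ci: "(\<lambda>s. complex_of_real (b s)) integrable_on {t (k - 1)..x}"
    using integrable_linear[OF bi bounded_linear_of_real] by (simp add: o_def)
  have "integral {t (k - 1)..x} (\<lambda>s. \<i> * complex_of_real (b s) - 1) =
      \<i> * complex_of_real (integral {t (k - 1)..x} b) - complex_of_real (x - t (k - 1))"
    using ci x cb by (subst Henstock_Kurzweil_Integration.integral_diff)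
      (auto intro!: integrable_on_mult_right simp: scaleR_conv_of_real)
  then show "\<i> * complex_of_real (piece_A k x) - complex_of_real x =
      \<i> * complex_of_real (A (t (k - 1))) - complex_of_real (t (k - 1)) +
      integral {t (k - 1)..x} (\<lambda>s. \<i> * complex_of_real (b s) - 1)"
    by (simp add: piece_A_def algebra_simps)
qed

lemma piece_exp_primitive:
  assumes k: "k \<in> {1..n}"
  shows "primitive (t (k - 1)) (t k) (\<lambda>x. (\<i> * complex_of_real (b x) - 1) * piece_exp k x) (piece_exp k)"
    and "primitive (t (k - 1)) (t k) (\<lambda>x. - (\<i> * complex_of_real (b x) - 1) * inverse (piece_exp k x))
          (\<lambda>x. inverse (piece_exp k x))"
proof -
  have bd: "norm (\<i> * complex_of_real (b x) - 1) \<le> C + 1" if "x \<in> {t (k - 1)..t k}" for x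
    using norm_triangle_ineq4[of "\<i> * complex_of_real (b x)" 1] b_bound[of x] piece_subset[OF k] that
    by (auto simp: norm_mult)
  note P = piece_exponent_primitive[OF k]
  show "primitive (t (k - 1)) (t k) (\<lambda>x. (\<i> * complex_of_real (b x) - 1) * piece_exp k x) (piece_exp k)"
    unfolding piece_exp_def by (rule primitive_exp[OF P bd])
  have "primitive (t (k - 1)) (t k) (\<lambda>x. (- 1) * (\<i> * complex_of_real (b x) - 1))
    (\<lambda>x. (- 1) * (\<i> * complex_of_real (piece_A k x) - complex_of_real x))"
    by (rule primitive_cmult[OF P])
  then have "primitive (t (k - 1)) (t k) (\<lambda>x. - (\<i> * complex_of_real (b x) - 1) * exp (- (\<i> * complex_of_real (piece_A k x) - complex_of_real x)))
    (\<lambda>x. exp (- (\<i> * complex_of_real (piece_A k x) - complex_of_real x)))"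
    by (intro primitive_exp[where C = "C + 1"]) (use bd in \<open>simp_all only: mult_minus1 norm_minus_cancel\<close>)
  then show "primitive (t (k - 1)) (t k) (\<lambda>x. - (\<i> * complex_of_real (b x) - 1) * inverse (piece_exp k x))
          (\<lambda>x. inverse (piece_exp k x))"
    by (simp only: piece_exp_def exp_minus)
qed

lemma exp_Phi_measurable: "(\<lambda>x. exp (Phi A x)) \<in> borel_measurable (lebesgue_on {0..L})"
  and exp_minus_Phi_measurable: "(\<lambda>x. exp (- Phi A x)) \<in> borel_measurable (lebesgue_on {0..L})"
proof -
  have [measurable]: "A \<in> borel_measurable (lebesgue_on {0..L})" by (rule A_measurable)
  have [measurable]: "(\<lambda>x. complex_of_real x) \<in> borel_measurable (lebesgue_on {0..L})"
    by (intro continuous_measurable_Icc continuous_intros)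
  have [measurable]: "Phi A \<in> borel_measurable (lebesgue_on {0..L})"
    unfolding Phi_def by measurable
  show "(\<lambda>x. exp (Phi A x)) \<in> borel_measurable (lebesgue_on {0..L})"
    "(\<lambda>x. exp (- Phi A x)) \<in> borel_measurable (lebesgue_on {0..L})" by measurable
qed

lemma Re_Phi: "Re (Phi A x) = - x"
  by (simp add: Phi_def)

lemma exp_Phi_L: "exp (Phi A L) - 1 \<noteq> 0"
proof
  assume "exp (Phi A L) - 1 = 0"
  then have "norm (exp (Phi A L)) = 1" by simp
  then show False using L_pos by (simp add: Re_Phi)
qed

definition weighted_integral :: "(real \<Rightarrow> complex) \<Rightarrow> real \<Rightarrow> complex" where
  "weighted_integral f x = integral {0..x} (\<lambda>s. exp (Phi A s) * f s)"

lemma exp_Phi_f_abs_int: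
  assumes "f \<in> l2_fun (lebesgue_on {0..L})"
  shows "(\<lambda>s. exp (Phi A s) * f s) absolutely_integrable_on {0..L}"
  by (rule abs_int_mult_bounded[OF exp_Phi_measurable _ l2_fun_abs_int[OF assms], of 1])
     (simp add: Re_Phi)

lemma LINT_exp_Phi:
  assumes "f \<in> l2_fun (lebesgue_on {0..L})" "x \<le> L"
  shows "integrable (lebesgue_on {0..x}) (\<lambda>s. exp (Phi A s) * f s)"
    and "(LINT s|lebesgue_on {0..x}. exp (Phi A s) * f s) = weighted_integral f x"
proof -
  have "(\<lambda>s. exp (Phi A s) * f s) absolutely_integrable_on {0..x}"
    by (rule set_integrable_subset[OF exp_Phi_f_abs_int[OF assms(1)]]) (use assms(2) in auto)
  then show "integrable (lebesgue_on {0..x}) (\<lambda>s. exp (Phi A s) * f s)"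
    by (rule absolutely_integrable_imp_integrable) simp
  then show "(LINT s|lebesgue_on {0..x}. exp (Phi A s) * f s) = weighted_integral f x"
    unfolding weighted_integral_def by (rule lebesgue_integral_eq_integral) simp
qed

text \<open>
  This is \<open>exp \<Phi> * R f\<close>, which is absolutely continuous across the jumps of \<open>A\<close>
  (\<open>R_fun_eq\<close>, \<open>weighted_R_primitive\<close>).
\<close>

definition weighted_R :: "(real \<Rightarrow> complex) \<Rightarrow> real \<Rightarrow> complex" where
  "weighted_R f x = \<i> * weighted_integral f L / (exp (Phi A L) - 1) + \<i> * weighted_integral f x"

lemma R_fun_eq:
  assumes f: "f \<in> l2_fun (lebesgue_on {0..L})" and x: "x \<le> L"
  shows "R_fun L A f x = exp (- Phi A x) * weighted_R f x"
proof -
  have "(LINT s|lebesgue_on {0..x}. exp (- (Phi A x - Phi A s)) * f s) =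
      (LINT s|lebesgue_on {0..x}. exp (- Phi A x) * (exp (Phi A s) * f s))"
    by (rule Bochner_Integration.integral_cong) (simp_all add: exp_minus exp_diff field_simps)
  also have "\<dots> = exp (- Phi A x) * weighted_integral f x"
    using LINT_exp_Phi[OF f x] by simp
  finally show ?thesis
    using LINT_exp_Phi(2)[OF f order_refl] by (simp add: R_fun_def weighted_R_def algebra_simps)
qed

lemma weighted_R_primitive:
  assumes f: "f \<in> l2_fun (lebesgue_on {0..L})"
  shows "primitive 0 L (\<lambda>s. \<i> * (exp (Phi A s) * f s)) (weighted_R f)"
proof (rule primitiveI[where c = "\<i> * weighted_integral f L / (exp (Phi A L) - 1)"])
  show "(\<lambda>s. \<i> * (exp (Phi A s) * f s)) absolutely_integrable_on {0..L}"
    by (rule set_integrable_mult_right[OF exp_Phi_f_abs_int[OF f]])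
qed (simp add: weighted_R_def weighted_integral_def)

text \<open>
  The constant term of the resolvent is chosen to make \<open>R f\<close> periodic, which after multiplication
  by the integrating factor reads as follows.
\<close>

lemma weighted_R_boundary: "exp (Phi A L) * weighted_R f 0 = weighted_R f L"
proof -
  have "weighted_R f 0 = \<i> * weighted_integral f L / (exp (Phi A L) - 1)" by (simp add: weighted_R_def weighted_integral_def)
  then show ?thesis using exp_Phi_L by (simp add: weighted_R_def field_simps)
qed

text \<open>
  Replacing \<open>exp \<Phi>\<close> by its continuous version on the piece, and \<open>f\<close> by a function equal to it
  before \<open>t k\<close>, changes the integrand only at the point \<open>t k\<close>.
\<close>

lemma primitive_piece:
  assumes k: "k \<in> {1..n}" and P: "primitive 0 L (\<lambda>s. \<i> * (exp (Phi A s) * f s)) W"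
    and fk: "\<And>x. t (k - 1) \<le> x \<Longrightarrow> x < t k \<Longrightarrow> f x = g x"
  shows "primitive (t (k - 1)) (t k) (\<lambda>s. \<i> * (piece_exp k s * g s)) W"
proof -
  have P': "primitive (t (k - 1)) (t k) (\<lambda>s. \<i> * (exp (Phi A s) * f s)) W"
    by (rule primitive_subinterval[OF P]) (use piece_subset[OF k] in auto)
  have eq: "\<i> * (piece_exp k s * g s) = \<i> * (exp (Phi A s) * f s)" if "s \<in> {t (k - 1)..x} - {t k}" "x \<le> t k" for s x
    using piece_exp_eq_exp_Phi[OF k, of s] fk[of s] that by auto
  show ?thesis
  proof (rule primitiveI[where c = "W (t (k - 1))"])
    show "(\<lambda>s. \<i> * (piece_exp k s * g s)) absolutely_integrable_on {t (k - 1)..t k}"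
      by (rule absolutely_integrable_spike[OF primitive_abs_int[OF P'], of "{t k}"]) (use eq in auto)
    fix x assume x: "t (k - 1) \<le> x" "x \<le> t k"
    have "integral {t (k - 1)..x} (\<lambda>s. \<i> * (exp (Phi A s) * f s)) = integral {t (k - 1)..x} (\<lambda>s. \<i> * (piece_exp k s * g s))"
      by (rule integral_spike[of "{t k}"]) (use eq x in auto)
    then show "W x = W (t (k - 1)) + integral {t (k - 1)..x} (\<lambda>s. \<i> * (piece_exp k s * g s))"
      using primitive_eq[OF P' x] by simp
  qed
qed

lemma R_fun_l2:
  assumes f: "f \<in> l2_fun (lebesgue_on {0..L})"
  shows "R_fun L A f \<in> l2_fun (lebesgue_on {0..L})"
proof -
  have l2: "(\<lambda>x. exp (- Phi A x) * weighted_R f x) \<in> l2_fun (lebesgue_on {0..L})"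
    by (rule l2_fun_mult[OF l2_fun_continuous[OF primitive_continuous[OF weighted_R_primitive[OF f]]]
         exp_minus_Phi_measurable, of "exp L"]) (auto simp: Re_Phi)
  have eq: "exp (- Phi A x) * weighted_R f x = R_fun L A f x" if "x \<in> space (lebesgue_on {0..L})" for x
    using R_fun_eq[OF f, of x] that by simp
  have "R_fun L A f \<in> borel_measurable (lebesgue_on {0..L}) \<longleftrightarrow>
      (\<lambda>x. exp (- Phi A x) * weighted_R f x) \<in> borel_measurable (lebesgue_on {0..L})"
    by (rule measurable_cong) (rule eq[symmetric])
  then have "R_fun L A f \<in> borel_measurable (lebesgue_on {0..L})"
    using l2_fun_measurable[OF l2] by blast
  then show ?thesis
    by (rule l2_fun_cong_AE[OF l2 _ AE_I2]) (rule eq)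
qed

lemma R_op_class:
  assumes f: "f \<in> l2_fun (lebesgue_on {0..L})"
  shows "R_op L A (l2_class (lebesgue_on {0..L}) f) = l2_class (lebesgue_on {0..L}) (R_fun L A f)"
proof -
  have "l2_class (lebesgue_on {0..L}) (R_fun L A g) = l2_class (lebesgue_on {0..L}) (R_fun L A f)"
    if "g \<in> l2_class (lebesgue_on {0..L}) f" for g
  proof -
    have g: "g \<in> l2_fun (lebesgue_on {0..L})" and AE: "AE x in lebesgue_on {0..L}. f x = g x"
      using that by (auto simp: l2_class_iff)
    have integral_eq: "weighted_integral g x = weighted_integral f x" if x: "x \<le> L" for x
    proof -
      have "(LINT s|lebesgue_on {0..x}. exp (Phi A s) * g s) = (LINT s|lebesgue_on {0..x}. exp (Phi A s) * f s)"
      proof (rule integral_cong_AE)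
        have "AE s in lebesgue_on {0..x}. f s = g s"
          by (rule AE_lebesgue_on_subset[OF AE]) (use x in auto)
        then show "AE s in lebesgue_on {0..x}. exp (Phi A s) * g s = exp (Phi A s) * f s"
          by eventually_elim simp
      qed (use LINT_exp_Phi(1)[OF f x] LINT_exp_Phi(1)[OF g x] in \<open>auto intro: borel_measurable_integrable\<close>)
      then show ?thesis using LINT_exp_Phi(2)[OF f x] LINT_exp_Phi(2)[OF g x] by simp
    qed
    show ?thesis
      by (rule l2_class_eqI[OF R_fun_l2[OF g] R_fun_l2[OF f]])
         (auto intro!: AE_I2 simp: R_fun_eq f g weighted_R_def integral_eq)
  qed
  then show ?thesis
    unfolding R_op_def using l2_class_self[OF f] by blast
qed

text \<open>
  If \<open>R f\<close> and \<open>R g\<close> agree, so do the absolutely continuous functions \<open>exp \<Phi> * R f\<close> and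
  \<open>exp \<Phi> * R g\<close>, and hence their derivatives \<open>i exp \<Phi> f\<close> and \<open>i exp \<Phi> g\<close>.
\<close>

lemma R_op_inj: "inj_on (R_op L A) (L2 {0..L})"
proof (rule inj_onI)
  fix F G assume "F \<in> L2 {0..L}" "G \<in> L2 {0..L}" and eq: "R_op L A F = R_op L A G"
  then obtain f g where f: "f \<in> l2_fun (lebesgue_on {0..L})" "F = l2_class (lebesgue_on {0..L}) f"
    and g: "g \<in> l2_fun (lebesgue_on {0..L})" "G = l2_class (lebesgue_on {0..L}) g"
    by (auto simp: L2_iff)
  have "AE x in lebesgue_on {0..L}. R_fun L A f x = R_fun L A g x"
    using eq by (intro l2_class_eqD R_fun_l2 f(1)) (simp add: f g R_op_class)
  moreover have "AE x in lebesgue_on {0..L}. x \<in> {0..L}"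
    by (rule AE_I2) simp
  ultimately have "AE x in lebesgue_on {0..L}. weighted_R f x = weighted_R g x"
    by eventually_elim (simp add: R_fun_eq f(1) g(1))
  then have "AE x in lebesgue_on {0..L}. \<i> * (exp (Phi A x) * f x) = \<i> * (exp (Phi A x) * g x)"
    by (rule primitive_AE_unique[OF L_pos weighted_R_primitive[OF f(1)] weighted_R_primitive[OF g(1)]])
  then have "AE x in lebesgue_on {0..L}. f x = g x" by eventually_elim simp
  then show "F = G" unfolding f(2) g(2) by (rule l2_class_eqI[OF f(1) g(1)])
qed

lemma AE_pieces:
  assumes "\<And>k. k \<in> {1..n} \<Longrightarrow> AE x in lebesgue_on {t (k - 1)..t k}. Q x"
  shows "AE x in lebesgue_on {0..L}. Q x"
proof -
  have "AE x in lebesgue. \<forall>k\<in>{1..n}. x \<in> {t (k - 1)..t k} \<longrightarrow> Q x"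
  proof (rule AE_finite_allI)
    fix k assume "k \<in> {1..n}"
    from assms[OF this] show "AE x in lebesgue. x \<in> {t (k - 1)..t k} \<longrightarrow> Q x"
      by (subst (asm) AE_restrict_space_iff) auto
  qed simp
  then have "AE x in lebesgue. x \<in> {0..L} \<longrightarrow> Q x"
  proof eventually_elim
    case (elim x)
    show ?case
    proof
      assume x: "x \<in> {0..L}"
      have "\<exists>k\<in>{1..n}. x \<in> {t (k - 1)..t k}"
      proof (cases "x = L")
        case True
        then show ?thesis using n_pos t_n t_step[of n] by (intro bexI[of _ n]) auto
      next
        case False
        then show ?thesis using piece_exists[of x] x by fastforce
      qed
      then show "Q x" using elim by blast
    qed
  qed
  then show ?thesis by (subst AE_restrict_space_iff) auto
qed

lemma IP_class:
  assumes "f \<in> l2_fun (lebesgue_on {0..L})"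
  shows "IP n t (l2_class (lebesgue_on {0..L}) f) = (\<lambda>k\<in>{1..n}. l2_class (lebesgue_on {t (k - 1)..t k}) f)"
  unfolding IP_def
  by (intro restrict_ext l2_restrict_class assms piece_subset) auto

lemma IP_inj: "inj_on (IP n t) (L2 {0..L})"
proof (rule inj_onI)
  fix F G assume "F \<in> L2 {0..L}" "G \<in> L2 {0..L}" and eq: "IP n t F = IP n t G"
  then obtain f g where f: "f \<in> l2_fun (lebesgue_on {0..L})" "F = l2_class (lebesgue_on {0..L}) f"
    and g: "g \<in> l2_fun (lebesgue_on {0..L})" "G = l2_class (lebesgue_on {0..L}) g"
    by (auto simp: L2_iff)
  have "AE x in lebesgue_on {0..L}. f x = g x"
  proof (rule AE_pieces)
    fix k assume k: "k \<in> {1..n}"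
    have "l2_class (lebesgue_on {t (k - 1)..t k}) f = l2_class (lebesgue_on {t (k - 1)..t k}) g"
      using fun_cong[OF eq, of k] k by (simp add: f g IP_class)
    then show "AE x in lebesgue_on {t (k - 1)..t k}. f x = g x"
      by (rule l2_class_eqD[OF piece_l2[OF f(1) k]])
  qed
  then show "F = G" unfolding f(2) g(2) by (rule l2_class_eqI[OF f(1) g(1)])
qed

lemma AE_piece_except_end:
  assumes "\<And>x. t (k - 1) \<le> x \<Longrightarrow> x < t k \<Longrightarrow> Q x"
  shows "AE x in lebesgue_on {t (k - 1)..t k}. Q x"
proof -
  have "AE x in lebesgue. x \<noteq> t k"
    using AE_not_in[of "{t k}" lebesgue] by simp
  then have "AE x in lebesgue. x \<in> {t (k - 1)..t k} \<longrightarrow> Q x"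
    by eventually_elim (use assms in auto)
  then show ?thesis by (subst AE_restrict_space_iff) auto
qed

lemma coefficient_on_piece:
  assumes "k \<in> {1..n}"
  shows "(\<lambda>x. complex_of_real (b x)) \<in> borel_measurable (lebesgue_on {t (k - 1)..t k})"
    "(\<lambda>x. complex_of_real (a x)) \<in> borel_measurable (lebesgue_on {t (k - 1)..t k})"
    "AE x in lebesgue_on {t (k - 1)..t k}. complex_of_real (b x) = complex_of_real (a x)"
    "\<And>x. x \<in> {t (k - 1)..t k} \<Longrightarrow> norm (complex_of_real (b x)) \<le> C"
proof -
  note [measurable] = piece_measurable[OF b_measurable assms] piece_measurable[OF a_measurable assms]
  show "(\<lambda>x. complex_of_real (b x)) \<in> borel_measurable (lebesgue_on {t (k - 1)..t k})"
    "(\<lambda>x. complex_of_real (a x)) \<in> borel_measurable (lebesgue_on {t (k - 1)..t k})" by measurable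
  have "AE x in lebesgue_on {t (k - 1)..t k}. b x = a x"
    by (rule AE_lebesgue_on_subset[OF b_eq_a piece_subset(3)[OF assms]]) auto
  then show "AE x in lebesgue_on {t (k - 1)..t k}. complex_of_real (b x) = complex_of_real (a x)"
    by eventually_elim simp
  show "norm (complex_of_real (b x)) \<le> C" if "x \<in> {t (k - 1)..t k}" for x
    using b_bound[of x] piece_subset(3)[OF assms] that by auto
qed

text \<open>
  On the piece \<open>k\<close> the class of \<open>R f\<close> has the continuous representative
  \<open>v k = exp (- \<Phi>\<^sub>k) exp \<Phi> R f\<close>, whose derivative is \<open>d k = (1 - i b) v k + i f\<close> by the product rule;
  therefore \<open>- i d k + b v k = f - i v k\<close>.
\<close>

lemma range_R_in_L_dom:
  assumes f: "f \<in> l2_fun (lebesgue_on {0..L})"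
  defines "u \<equiv> R_fun L A f"
  shows "IP n t (l2_class (lebesgue_on {0..L}) u) \<in> L_dom n t A"
    and "L_op n t A a (IP n t (l2_class (lebesgue_on {0..L}) u)) =
      Some (IP n t (l2_class (lebesgue_on {0..L}) (\<lambda>x. f x + (- \<i>) * u x)))"
proof -
  define v where "v k x = inverse (piece_exp k x) * weighted_R f x" for k x
  define d where "d k x = (- (\<i> * complex_of_real (b x) - 1)) * v k x + \<i> * f x" for k x
  let ?M = "\<lambda>k. lebesgue_on {t (k - 1)..t k}"
  let ?U = "IP n t (l2_class (lebesgue_on {0..L}) u)"
  have u_l2: "u \<in> l2_fun (lebesgue_on {0..L})" unfolding u_def by (rule R_fun_l2[OF f])
  have w_piece: "primitive (t (k - 1)) (t k) (\<lambda>s. \<i> * (piece_exp k s * f s)) (weighted_R f)" if k: "k \<in> {1..n}" for k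
    by (rule primitive_piece[OF k weighted_R_primitive[OF f]]) simp
  have b_bd: "norm (- (\<i> * complex_of_real (b x) - 1)) \<le> C + 1" if "k \<in> {1..n}" "x \<in> {t (k - 1)..t k}" for k x
    using norm_triangle_ineq4[of "\<i> * complex_of_real (b x)" 1] coefficient_on_piece(4)[OF that]
    by (simp add: norm_mult norm_minus_commute)
  have v_prim: "primitive (t (k - 1)) (t k) (d k) (v k)" if k: "k \<in> {1..n}" for k
  proof -
    obtain D where D: "\<And>x. x \<in> {t (k - 1)..t k} \<Longrightarrow> norm (inverse (piece_exp k x)) \<le> D"
      using continuous_bounded_Icc[OF primitive_continuous[OF piece_exp_primitive(2)[OF k]]] by metis
    have bd: "norm (- (\<i> * complex_of_real (b x) - 1) * inverse (piece_exp k x)) \<le> (C + 1) * D" if "x \<in> {t (k - 1)..t k}" for x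
      unfolding norm_mult using b_bd[OF k that] D[OF that] coefficient_on_piece(4)[OF k that] 
      by (intro mult_mono) (auto intro: order_trans[OF norm_ge_zero])
    show ?thesis
      using primitive_mult[OF piece_exp_primitive(2)[OF k] w_piece[OF k] bd]
      by (rule primitive_cong) (use piece_exp_nonzero in \<open>simp_all add: d_def v_def field_simps\<close>)
  qed
  have v_l2: "v k \<in> l2_fun (?M k)" if k: "k \<in> {1..n}" for k
    by (rule l2_fun_continuous[OF primitive_continuous[OF v_prim[OF k]]])
  have d_l2: "d k \<in> l2_fun (?M k)" if k: "k \<in> {1..n}" for k
    unfolding d_def
    using b_bd[OF k] coefficient_on_piece(1)[OF k]
    by (intro l2_fun_add l2_fun_mult[OF v_l2[OF k], where C = "C + 1"] l2_fun_cmult piece_l2[OF f k]) auto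
  have u_v: "AE x in ?M k. u x = v k x" if k: "k \<in> {1..n}" for k
  proof (rule AE_piece_except_end)
    fix x assume x: "t (k - 1) \<le> x" "x < t k"
    then have "x \<le> L" using piece_subset[OF k] by simp
    then show "u x = v k x"
      using piece_exp_eq_exp_Phi[OF k x(1)] x(2) R_fun_eq[OF f, of x] by (simp add: u_def v_def exp_minus)
  qed
  have class_eq: "l2_class (?M k) u = l2_class (?M k) (v k)" if k: "k \<in> {1..n}" for k
    by (rule l2_class_eqI[OF piece_l2[OF u_l2 k] v_l2[OF k] u_v[OF k]])
  have U: "?U k = l2_class (?M k) (v k)" if k: "k \<in> {1..n}" for k
    using k class_eq[OF k] by (simp add: IP_class[OF u_l2])
  have cont_value: "cont_value (t (k - 1)) (t k) (?U k) x = v k x" if "k \<in> {1..n}" "x \<in> {t (k - 1)..t k}" for k x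
    unfolding U[OF that(1)] by (rule sobolev_primitive(3)[OF t_step v_prim d_l2]) (use that in auto)
  show dom: "?U \<in> L_dom n t A"
    unfolding L_dom_def
  proof (intro CollectI conjI ballI)
    show "?U \<in> HP n t"
      unfolding IP_class[OF u_l2] HP_def by (auto intro!: L2_classI piece_l2[OF u_l2, simplified])
    show "?U k \<in> sobolev (t (k - 1)) (t k)" if "k \<in> {1..n}" for k
      unfolding U[OF that] by (rule sobolev_primitive(1)[OF t_step v_prim d_l2]) (use that in auto)
    show "cont_value (t j) (t (j + 1)) (?U (j + 1)) (t j) =
        exp (- \<i> * complex_of_real (jump A (t j))) * cont_value (t (j - 1)) (t j) (?U j) (t j)"
      if j: "j \<in> {1..<n}" for j
    proof -
      have j1: "j \<in> {1..n}" and j2: "Suc j \<in> {1..n}" using j by auto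
      have "cont_value (t j) (t (j + 1)) (?U (j + 1)) (t j) = v (Suc j) (t j)"
        using cont_value[OF j2, of "t j"] t_step[OF j2] by simp
      moreover have "cont_value (t (j - 1)) (t j) (?U j) (t j) = v j (t j)"
        using cont_value[OF j1, of "t j"] t_step[OF j1] by simp
      moreover have "v (Suc j) (t j) = exp (- \<i> * complex_of_real (jump A (t j))) * v j (t j)"
        unfolding v_def piece_exp_junction[OF j, symmetric] by (simp add: piece_exp_nonzero)
      ultimately show ?thesis by simp
    qed
    have "cont_value (t (n - 1)) (t n) (?U n) (t n) = v n L"
      using cont_value[of n "t n"] t_step[of n] n_pos t_n by simp
    moreover have "cont_value (t 0) (t 1) (?U 1) (t 0) = v 1 0"
      using cont_value[of 1 "t 0"] t_step[of 1] n_pos t_0 by simp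
    moreover have "v n L = v 1 0"
    proof -
      have "piece_exp n L = exp (Phi A L)"
        by (rule piece_exp_eq_exp_Phi) (use n_pos t_step[of n] t_n in auto)
      moreover have "piece_exp 1 0 = 1" by (simp add: piece_exp_def piece_A_def t_0 A_0)
      ultimately show ?thesis
        unfolding v_def using weighted_R_boundary[of f] by (simp add: field_simps)
    qed
    ultimately show "cont_value (t (n - 1)) (t n) (?U n) (t n) = cont_value (t 0) (t 1) (?U 1) (t 0)"
      by simp
  qed
  have op_value: "l2_add {t (k - 1)..t k}
        (l2_mult {t (k - 1)..t k} (\<lambda>_. - \<i>) (weak_deriv (t (k - 1)) (t k) (?U k)))
        (l2_mult {t (k - 1)..t k} (\<lambda>x. complex_of_real (a x)) (?U k)) =
      l2_class (?M k) (\<lambda>x. f x + (- \<i>) * u x)" if k: "k \<in> {1..n}" for k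
  proof -
    have wd: "weak_deriv (t (k - 1)) (t k) (?U k) = l2_class (?M k) (d k)"
      unfolding U[OF k] by (rule sobolev_primitive(2)[OF t_step[OF k] v_prim[OF k] d_l2[OF k]])
    have m1: "l2_mult {t (k - 1)..t k} (\<lambda>_. - \<i>) (l2_class (?M k) (d k)) = l2_class (?M k) (\<lambda>x. (- \<i>) * d k x)"
      by (rule l2_mult_class[OF d_l2[OF k], where C = 1]) auto
    have m2: "l2_mult {t (k - 1)..t k} (\<lambda>x. complex_of_real (a x)) (l2_class (?M k) (v k)) =
        l2_class (?M k) (\<lambda>x. complex_of_real (b x) * v k x)"
      by (rule l2_mult_class[OF v_l2[OF k] coefficient_on_piece(1)[OF k] coefficient_on_piece(4)[OF k]
          coefficient_on_piece(2,3)[OF k]])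
    have l2s: "(\<lambda>x. (- \<i>) * d k x) \<in> l2_fun (?M k)" "(\<lambda>x. complex_of_real (b x) * v k x) \<in> l2_fun (?M k)"
      by (rule l2_fun_cmult[OF d_l2[OF k]])
        (rule l2_fun_mult[OF v_l2[OF k] coefficient_on_piece(1)[OF k] coefficient_on_piece(4)[OF k]], simp)
    have "l2_class (?M k) (\<lambda>x. (- \<i>) * d k x + complex_of_real (b x) * v k x) =
        l2_class (?M k) (\<lambda>x. f x + (- \<i>) * u x)"
    proof (rule l2_class_eqI)
      show "AE x in ?M k. (- \<i>) * d k x + complex_of_real (b x) * v k x = f x + (- \<i>) * u x"
        using u_v[OF k] by eventually_elim (simp add: d_def algebra_simps)
    qed (intro l2_fun_add l2s l2_fun_cmult piece_l2[OF f k] piece_l2[OF u_l2 k])+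
    then show ?thesis
      unfolding wd unfolding U[OF k] m1 m2 by (simp only: l2_add_class[OF l2s])
  qed
  have "(\<lambda>x. f x + (- \<i>) * u x) \<in> l2_fun (lebesgue_on {0..L})"
    by (intro l2_fun_add l2_fun_cmult f u_l2)
  then show "L_op n t A a ?U = Some (IP n t (l2_class (lebesgue_on {0..L}) (\<lambda>x. f x + (- \<i>) * u x)))"
    unfolding L_op_def total_op_def restrict_map_def using dom op_value
    by (simp only: IP_class if_True) (intro arg_cong[where f = Some] restrict_ext, simp)
qed

text \<open>
  Gluing is done on half-open pieces, so that at most one summand is nonzero at each point of
  \<open>[0, L)\<close>.
\<close>

lemma l2_fun_glue:
  assumes "\<And>k. k \<in> {1..n} \<Longrightarrow> g k \<in> l2_fun (lebesgue_on {t (k - 1)..t k})"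
  obtains f where "f \<in> l2_fun (lebesgue_on {0..L})"
    "\<And>k x. k \<in> {1..n} \<Longrightarrow> t (k - 1) \<le> x \<Longrightarrow> x < t k \<Longrightarrow> f x = g k x"
proof
  define h where "h k x = (if x \<in> {t (k - 1)..<t k} then g k x else 0)" for k x
  show "(\<lambda>x. \<Sum>k\<in>{1..n}. h k x) \<in> l2_fun (lebesgue_on {0..L})"
  proof -
    have h: "h k \<in> l2_fun (lebesgue_on {0..L})" if k: "k \<in> {1..n}" for k
    proof -
      have half: "g k \<in> l2_fun (lebesgue_on {t (k - 1)..<t k})"
        by (rule l2_fun_subset[OF assms[OF k]]) auto
      have "h k \<in> borel_measurable lebesgue"
        unfolding h_def by (rule borel_measurable_if_I[OF l2_fun_measurable[OF half]]) simp
      moreover have "integrable lebesgue (\<lambda>x. (norm (h k x))\<^sup>2)"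
      proof -
        have "integrable lebesgue (\<lambda>x. indicat_real {t (k - 1)..<t k} x *\<^sub>R (norm (g k x))\<^sup>2)"
          using half unfolding l2_fun_def by (simp add: integrable_restrict_space)
        also have "(\<lambda>x. indicat_real {t (k - 1)..<t k} x *\<^sub>R (norm (g k x))\<^sup>2) = (\<lambda>x. (norm (h k x))\<^sup>2)"
          by (auto simp: h_def indicator_def)
        finally show ?thesis .
      qed
      ultimately have "h k \<in> l2_fun (lebesgue_on UNIV)"
        by (simp add: l2_fun_def lebesgue_on_UNIV_eq)
      then show ?thesis by (rule l2_fun_subset) auto
    qed
    have "(\<lambda>x. \<Sum>k\<in>K. h k x) \<in> l2_fun (lebesgue_on {0..L})" if "K \<subseteq> {1..n}" "finite K" for K
      using that(2,1)
    proof (induction K)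
      case empty
      show ?case using l2_fun_continuous[of 0 L "\<lambda>_. 0"] by simp
    next
      case (insert k K)
      then show ?case using l2_fun_add[OF h[of k]] by simp
    qed
    then show ?thesis by simp
  qed
  fix k x assume k: "k \<in> {1..n}" and x: "t (k - 1) \<le> x" "x < t k"
  have "h j x = (if j = k then g k x else 0)" if "j \<in> {1..n}" for j
  proof (cases "j = k")
    case False
    then have "x \<notin> {t (j - 1)..<t j}"
      using piece_unique[OF k that x] by (metis atLeastLessThan_iff)
    then show ?thesis using False by (simp only: h_def if_False)
  qed (use x in \<open>simp add: h_def\<close>)
  then have "(\<Sum>j\<in>{1..n}. h j x) = (\<Sum>j\<in>{1..n}. if j = k then g k x else 0)"
    by (intro sum.cong) auto
  then show "(\<Sum>j\<in>{1..n}. h j x) = g k x"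
    using k by simp
qed

text \<open>
  The function \<open>f\<close> glued from \<open>g k = - i v k + (b + i) u k\<close>, where \<open>v k\<close> is the derivative of
  \<open>u k\<close>, is the only candidate. Let \<open>W\<close> be the primitive of \<open>i exp \<Phi> f\<close> with initial value \<open>u 1 0\<close>.
  By induction over the pieces, \<open>W\<close> agrees with \<open>exp \<Phi>\<^sub>k u k\<close>: the matching condition at \<open>t k\<close>
  transports the equality to the start of the next piece. At \<open>L\<close> periodicity gives the equation
  \<open>exp (\<Phi> L) u 1 0 = u 1 0 + i \<integral> exp \<Phi> f\<close>, whose solution is the constant in \<open>R f\<close>.
\<close>

lemma L_dom_subset_range_R:
  assumes U: "U \<in> L_dom n t A"
  obtains f where "f \<in> l2_fun (lebesgue_on {0..L})"
    "U = IP n t (l2_class (lebesgue_on {0..L}) (R_fun L A f))"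
proof -
  let ?M = "\<lambda>k. lebesgue_on {t (k - 1)..t k}"
  have "\<forall>k\<in>{1..n}. \<exists>v u. primitive (t (k - 1)) (t k) v u \<and> v \<in> l2_fun (?M k) \<and> U k = l2_class (?M k) u"
  proof
    fix k assume k: "k \<in> {1..n}"
    have "U k \<in> sobolev (t (k - 1)) (t k)" using U k unfolding L_dom_def by blast
    then obtain V where "U k \<in> L2 {t (k - 1)..t k}" "V \<in> L2 {t (k - 1)..t k}"
      "is_weak_deriv (t (k - 1)) (t k) (U k) V" unfolding sobolev_def by blast
    then show "\<exists>v u. primitive (t (k - 1)) (t k) v u \<and> v \<in> l2_fun (?M k) \<and> U k = l2_class (?M k) u"
      using is_weak_deriv_obtain_primitive[OF t_step[OF k]] by metis
  qed
  then obtain v u where prim: "\<And>k. k \<in> {1..n} \<Longrightarrow> primitive (t (k - 1)) (t k) (v k) (u k)"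
    and v_l2: "\<And>k. k \<in> {1..n} \<Longrightarrow> v k \<in> l2_fun (?M k)"
    and U_eq: "\<And>k. k \<in> {1..n} \<Longrightarrow> U k = l2_class (?M k) (u k)"
    by metis
  have u_l2: "u k \<in> l2_fun (?M k)" if k: "k \<in> {1..n}" for k
    by (rule l2_fun_continuous[OF primitive_continuous[OF prim[OF k]]])
  have cont_value: "cont_value (t (k - 1)) (t k) (U k) x = u k x" if "k \<in> {1..n}" "x \<in> {t (k - 1)..t k}" for k x
    unfolding U_eq[OF that(1)] by (rule sobolev_primitive(3)[OF t_step prim v_l2]) (use that in auto)
  have match: "u (Suc j) (t j) = exp (- \<i> * complex_of_real (jump A (t j))) * u j (t j)" if j: "j \<in> {1..<n}" for j
  proof -
    have j1: "j \<in> {1..n}" and j2: "Suc j \<in> {1..n}" using j by auto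
    have "cont_value (t j) (t (j + 1)) (U (j + 1)) (t j) =
        exp (- \<i> * complex_of_real (jump A (t j))) * cont_value (t (j - 1)) (t j) (U j) (t j)"
      using U j unfolding L_dom_def by blast
    then show ?thesis
      using cont_value[OF j2, of "t j"] t_step[OF j2] cont_value[OF j1, of "t j"] t_step[OF j1] by simp
  qed
  have periodic: "u n L = u 1 0"
  proof -
    have "cont_value (t (n - 1)) (t n) (U n) (t n) = cont_value (t 0) (t 1) (U 1) (t 0)"
      using U unfolding L_dom_def by blast
    then show ?thesis
      using cont_value[of n "t n"] t_step[of n] n_pos t_n cont_value[of 1 "t 0"] t_step[of 1] t_0 by simp
  qed
  define g where "g k x = (- \<i>) * v k x + (complex_of_real (b x) + \<i>) * u k x" for k x
  have g_l2: "g k \<in> l2_fun (?M k)" if k: "k \<in> {1..n}" for k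
    unfolding g_def
  proof (intro l2_fun_add l2_fun_cmult v_l2[OF k] l2_fun_mult[OF u_l2[OF k], where C = "C + 1"])
    show "(\<lambda>x. complex_of_real (b x) + \<i>) \<in> borel_measurable (?M k)"
      using coefficient_on_piece(1)[OF k] by simp
    show "norm (complex_of_real (b x) + \<i>) \<le> C + 1" if "x \<in> space (?M k)" for x
      using norm_triangle_ineq[of "complex_of_real (b x)" \<i>] coefficient_on_piece(4)[OF k, of x] that by simp
  qed
  obtain f where f: "f \<in> l2_fun (lebesgue_on {0..L})"
    and f_eq: "\<And>k x. k \<in> {1..n} \<Longrightarrow> t (k - 1) \<le> x \<Longrightarrow> x < t k \<Longrightarrow> f x = g k x"
    using l2_fun_glue[OF g_l2] by metis
  define W where "W x = u 1 0 + \<i> * weighted_integral f x" for x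
  have W_prim: "primitive 0 L (\<lambda>s. \<i> * (exp (Phi A s) * f s)) W"
  proof (rule primitiveI[where c = "u 1 0"])
    show "(\<lambda>s. \<i> * (exp (Phi A s) * f s)) absolutely_integrable_on {0..L}"
      by (rule set_integrable_mult_right[OF exp_Phi_f_abs_int[OF f]])
  qed (simp add: W_def weighted_integral_def)
  have piece: "piece_exp k x * u k x = W x"
    if k: "k \<in> {1..n}" and start: "piece_exp k (t (k - 1)) * u k (t (k - 1)) = W (t (k - 1))"
      and x: "t (k - 1) \<le> x" "x \<le> t k" for k x
  proof -
    obtain D where D: "\<And>x. x \<in> {t (k - 1)..t k} \<Longrightarrow> norm (piece_exp k x) \<le> D"
      using continuous_bounded_Icc[OF primitive_continuous[OF piece_exp_primitive(1)[OF k]]] by metis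
    have bd: "norm ((\<i> * complex_of_real (b x) - 1) * piece_exp k x) \<le> (C + 1) * D" if "x \<in> {t (k - 1)..t k}" for x
    proof -
      have "norm (\<i> * complex_of_real (b x) - 1) \<le> C + 1"
        using norm_triangle_ineq4[of "\<i> * complex_of_real (b x)" 1] coefficient_on_piece(4)[OF k that]
        by (simp add: norm_mult)
      then show ?thesis
        unfolding norm_mult using D[OF that] coefficient_on_piece(4)[OF k that]
        by (intro mult_mono) (auto intro: order_trans[OF norm_ge_zero])
    qed
    have P1: "primitive (t (k - 1)) (t k) (\<lambda>s. \<i> * (piece_exp k s * g k s)) (\<lambda>x. piece_exp k x * u k x)"
      using primitive_mult[OF piece_exp_primitive(1)[OF k] prim[OF k] bd]
      by (rule primitive_cong) (simp_all add: g_def algebra_simps)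
    have P2: "primitive (t (k - 1)) (t k) (\<lambda>s. \<i> * (piece_exp k s * g k s)) W"
      by (rule primitive_piece[OF k W_prim]) (use f_eq[OF k] in auto)
    show ?thesis
      unfolding primitive_eq[OF P1 x] primitive_eq[OF P2 x] start ..
  qed
  have start: "k \<in> {1..n} \<Longrightarrow> piece_exp k (t (k - 1)) * u k (t (k - 1)) = W (t (k - 1))" for k
  proof (induction k)
    case (Suc k)
    show ?case
    proof (cases "k = 0")
      case True
      have "piece_exp 1 0 = 1" by (simp add: piece_exp_def piece_A_def t_0 A_0)
      then show ?thesis using True t_0 by (simp add: W_def weighted_integral_def)
    next
      case False
      then have k: "k \<in> {1..<n}" "k \<in> {1..n}" using Suc.prems by auto
      have "piece_exp (Suc k) (t k) * u (Suc k) (t k) = piece_exp k (t k) * u k (t k)"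
        unfolding match[OF k(1)] piece_exp_junction[OF k(1), symmetric] by simp
      also have "\<dots> = W (t k)"
        by (rule piece[OF k(2) Suc.IH[OF k(2)]]) (use t_step[OF k(2)] in auto)
      finally show ?thesis by simp
    qed
  qed simp
  have W_on_piece: "piece_exp k x * u k x = W x" if "k \<in> {1..n}" "t (k - 1) \<le> x" "x \<le> t k" for k x
    by (rule piece[OF that(1) start[OF that(1)] that(2,3)])
  have "exp (Phi A L) * u 1 0 = u 1 0 + \<i> * weighted_integral f L"
  proof -
    have "piece_exp n L = exp (Phi A L)"
      by (rule piece_exp_eq_exp_Phi) (use n_pos t_step[of n] t_n in auto)
    moreover have "piece_exp n L * u n L = W L"
      by (rule W_on_piece) (use n_pos t_step[of n] t_n in auto)
    ultimately show ?thesis by (simp add: periodic W_def)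
  qed
  then have "u 1 0 = \<i> * weighted_integral f L / (exp (Phi A L) - 1)"
    using exp_Phi_L by (simp add: field_simps)
  then have W_eq: "W = weighted_R f"
    by (simp add: fun_eq_iff W_def weighted_R_def)
  have "U k = l2_class (?M k) (R_fun L A f)" if k: "k \<in> {1..n}" for k
    unfolding U_eq[OF k]
  proof (rule l2_class_eqI[OF u_l2[OF k] piece_l2[OF R_fun_l2[OF f] k] AE_piece_except_end])
    fix x assume x: "t (k - 1) \<le> x" "x < t k"
    have "x \<le> L" using x piece_subset[OF k] by simp
    moreover have "exp (Phi A x) * u k x = weighted_R f x"
      using W_on_piece[OF k, of x] piece_exp_eq_exp_Phi[OF k, of x] x W_eq by simp
    ultimately show "u k x = R_fun L A f x"
      by (simp add: R_fun_eq[OF f] exp_minus field_simps)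
  qed
  moreover have "U \<in> extensional {1..n}"
    using U by (auto simp: L_dom_def HP_def PiE_def)
  ultimately have "U = IP n t (l2_class (lebesgue_on {0..L}) (R_fun L A f))"
    unfolding IP_class[OF R_fun_l2[OF f]] by (intro ext) (auto simp: extensional_def)
  then show ?thesis using that f by blast
qed

lemma T_op_class:
  assumes f: "f \<in> l2_fun (lebesgue_on {0..L})"
  shows "T_op L A (l2_class (lebesgue_on {0..L}) (R_fun L A f)) =
    Some (l2_class (lebesgue_on {0..L}) (\<lambda>x. f x + (- \<i>) * R_fun L A f x))"
proof -
  let ?F = "l2_class (lebesgue_on {0..L}) f" and ?U = "l2_class (lebesgue_on {0..L}) (R_fun L A f)"
  have "the_inv_into (L2 {0..L}) (R_op L A) ?U = ?F"
    using the_inv_into_f_f[OF R_op_inj L2_classI[OF f]] by (simp add: R_op_class[OF f])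
  moreover have "?U \<in> R_op L A ` L2 {0..L}"
    using R_op_class[OF f] L2_classI[OF f] by (metis imageI)
  ultimately have "inverse_op (L2 {0..L}) (R_op L A) ?U = Some ?F"
    by (simp add: inverse_op_def total_op_def)
  moreover have "l2_mult {0..L} (\<lambda>_. - \<i>) ?U = l2_class (lebesgue_on {0..L}) (\<lambda>x. (- \<i>) * R_fun L A f x)"
    by (rule l2_mult_class[OF R_fun_l2[OF f], where C = 1]) auto
  ultimately show ?thesis
    by (simp only: T_op_def option.map l2_add_class[OF f l2_fun_cmult[OF R_fun_l2[OF f]]])
qed

lemma T_op_domain:
  assumes "T_op L A F \<noteq> None"
  obtains f where "f \<in> l2_fun (lebesgue_on {0..L})" "F = l2_class (lebesgue_on {0..L}) (R_fun L A f)"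
proof -
  have "F \<in> R_op L A ` L2 {0..L}"
    using assms by (auto simp: T_op_def inverse_op_def total_op_def restrict_map_def split: if_splits)
  then show ?thesis using that by (auto simp: L2_iff R_op_class)
qed

lemma inverse_IP:
  assumes "F \<in> L2 {0..L}"
  shows "inverse_op (L2 {0..L}) (IP n t) (IP n t F) = Some F"
  using the_inv_into_f_f[OF IP_inj assms] assms by (simp add: inverse_op_def total_op_def)

text \<open>
  Both sides are defined exactly on the restrictions of functions \<open>R f\<close>, where the preceding
  lemmas determine their values.
\<close>

lemma L_op_eq_conjugated_T_op:
  "L_op n t A a = total_op (L2 {0..L}) (IP n t) \<circ>\<^sub>m T_op L A \<circ>\<^sub>m inverse_op (L2 {0..L}) (IP n t)"
proof
  fix U
  let ?rhs = "total_op (L2 {0..L}) (IP n t) \<circ>\<^sub>m T_op L A \<circ>\<^sub>m inverse_op (L2 {0..L}) (IP n t)"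
  have rhs: "?rhs (IP n t (l2_class (lebesgue_on {0..L}) (R_fun L A f))) =
      L_op n t A a (IP n t (l2_class (lebesgue_on {0..L}) (R_fun L A f)))"
    if f: "f \<in> l2_fun (lebesgue_on {0..L})" for f
  proof -
    have "(\<lambda>x. f x + (- \<i>) * R_fun L A f x) \<in> l2_fun (lebesgue_on {0..L})"
      by (intro l2_fun_add l2_fun_cmult f R_fun_l2)
    then show ?thesis
      using inverse_IP[OF L2_classI[OF R_fun_l2[OF f]]] T_op_class[OF f] range_R_in_L_dom(2)[OF f]
      by (simp add: map_comp_def total_op_def L2_classI)
  qed
  show "L_op n t A a U = ?rhs U"
  proof (cases "U \<in> L_dom n t A")
    case True
    then show ?thesis using L_dom_subset_range_R[OF True] rhs by metis
  next
    case False
    have "?rhs U = None"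
    proof (rule ccontr)
      assume "?rhs U \<noteq> None"
      then obtain F where F: "inverse_op (L2 {0..L}) (IP n t) U = Some F" "T_op L A F \<noteq> None"
        by (auto simp: map_comp_def split: option.splits)
      have "U = IP n t F"
        using F(1) f_the_inv_into_f[OF IP_inj]
        by (auto simp: inverse_op_def total_op_def restrict_map_def split: if_splits)
      moreover obtain f where "f \<in> l2_fun (lebesgue_on {0..L})" "F = l2_class (lebesgue_on {0..L}) (R_fun L A f)"
        using T_op_domain[OF F(2)] .
      ultimately show False using range_R_in_L_dom(1) False by simp
    qed
    moreover have "L_op n t A a U = None"
      using False by (simp add: L_op_def total_op_def)
    ultimately show ?thesis by simp
  qed
qed

end

section \<open>Nice functions\<close>

lemma heaviside_left_limit:
  "((\<lambda>x. heaviside (x - q)) \<longlongrightarrow> (if q = p then 0 else heaviside (p - q))) (at_left p)"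
proof (cases "q < p")
  case True
  have "eventually (\<lambda>x. 1 = heaviside (x - q)) (at_left p)"
    unfolding eventually_at_left_field using True by (intro exI[of _ q]) (auto simp: heaviside_def)
  from Lim_transform_eventually[OF tendsto_const this] show ?thesis
    using True by (simp add: heaviside_def)
next
  case False
  have "eventually (\<lambda>x. 0 = heaviside (x - q)) (at_left p)"
    unfolding eventually_at_left_field using False by (intro exI[of _ "p - 1"]) (auto simp: heaviside_def)
  from Lim_transform_eventually[OF tendsto_const this] show ?thesis
    using False by (auto simp: heaviside_def)
qed

text \<open>
  At \<open>p\<close> the left limit of the step part misses exactly the summand \<open>c p\<close>. Hence a step placed at a
  point of continuity has height zero, although the representation of \<open>A\<close> may list such points.
\<close>

lemma step_coefficient_zero_if_continuous:
  fixes A :: "real \<Rightarrow> real"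
  assumes A: "\<And>x. x \<in> {0..L} \<Longrightarrow> A x = F x + (\<Sum>q\<in>Q. c q * heaviside (x - q))"
    and F: "continuous_on {0..L} F" and Q: "finite Q" and p: "p \<in> Q" "0 < p" "p < L"
    and cont: "continuous (at p within {0..L}) A"
  shows "c p = 0"
proof -
  have left: "(G \<longlongrightarrow> G p) (at_left p)" if "continuous (at p within {0..L}) G" for G :: "real \<Rightarrow> real"
  proof -
    have "(G \<longlongrightarrow> G p) (at p)"
      using that at_within_Icc_at[of 0 p L] p by (simp add: continuous_within)
    then show ?thesis by (rule tendsto_within_subset) auto
  qed
  have "continuous (at p within {0..L}) F"
    using F p by (simp add: continuous_on_eq_continuous_within)
  then have "((\<lambda>x. F x + (\<Sum>q\<in>Q. c q * heaviside (x - q))) \<longlongrightarrow>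
      F p + (\<Sum>q\<in>Q. c q * (if q = p then 0 else heaviside (p - q)))) (at_left p)"
    by (intro tendsto_add left tendsto_sum tendsto_mult_left heaviside_left_limit)
  moreover have "eventually (\<lambda>x. F x + (\<Sum>q\<in>Q. c q * heaviside (x - q)) = A x) (at_left p)"
    unfolding eventually_at_left_field using p A by (intro exI[of _ 0]) auto
  ultimately have "(A \<longlongrightarrow> F p + (\<Sum>q\<in>Q. c q * (if q = p then 0 else heaviside (p - q)))) (at_left p)"
    by (rule Lim_transform_eventually)
  then have "A p = F p + (\<Sum>q\<in>Q. c q * (if q = p then 0 else heaviside (p - q)))"
    by (rule tendsto_unique[OF trivial_limit_at_left_real left[OF cont]])
  then have "(\<Sum>q\<in>Q. c q * heaviside (p - q)) = (\<Sum>q\<in>Q. c q * (if q = p then 0 else heaviside (p - q)))"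
    using A[of p] p by simp
  then have "0 = (\<Sum>q\<in>Q. c q * heaviside (p - q) - c q * (if q = p then 0 else heaviside (p - q)))"
    by (simp add: sum_subtractf)
  also have "\<dots> = (\<Sum>q\<in>Q. if q = p then c p else 0)"
    by (rule sum.cong) (auto simp: heaviside_def)
  also have "\<dots> = c p" using Q p by simp
  finally show ?thesis by simp
qed

lemma indicator_measurable_lebesgue_on:
  "S \<in> sets lebesgue \<Longrightarrow> indicat_real S \<in> borel_measurable (lebesgue_on T)"
  by (rule measurable_restrict_space1[OF borel_measurable_indicator])

text \<open>
  Steps of nonzero height occur only at partition points, so on a piece (without its right end
  point, unless that is \<open>L\<close>) all increments of \<open>A\<close> come from the absolutely continuous part.
\<close>

lemma nice_imp_piecewise_phase:
  assumes L: "L > 0" and nice: "nice L A" and density: "nice_density L A a"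
    and partition: "is_partition L n t" and disc: "discontinuities L A \<subseteq> t ` {1..<n}"
  obtains b C where "piecewise_phase L A a b C n t"
proof -
  obtain C Q c where a_meas: "a \<in> borel_measurable (lebesgue_on {0<..<L})"
    and C: "AE x in lebesgue_on {0<..<L}. \<bar>a x\<bar> \<le> C"
    and Q: "finite Q" "Q \<subseteq> {0<..<L}"
    and A: "\<And>x. x \<in> {0..L} \<Longrightarrow>
        A x = (LINT s|lebesgue_on {0..x}. a s) + (\<Sum>p\<in>Q. c p * heaviside (x - p))"
    using density unfolding nice_density_def Linfty_fun_def by blast
  define b where "b x = (if x \<in> {0<..<L} then if \<bar>a x\<bar> \<le> C then a x else 0 else 0)" for x
  have [measurable]: "{0<..<L} \<in> sets lebesgue" by simp
  have b_meas_all: "b \<in> borel_measurable lebesgue"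
  proof -
    have "(\<lambda>x. if \<bar>a x\<bar> \<le> C then a x else 0) \<in> borel_measurable (lebesgue_on {0<..<L})"
      using a_meas by measurable
    then show ?thesis unfolding b_def by (rule borel_measurable_if_I) simp
  qed
  then have b_meas: "b \<in> borel_measurable (lebesgue_on S)" for S
    by (rule measurable_restrict_space1)
  have a_meas': "a \<in> borel_measurable (lebesgue_on {0..L})"
  proof -
    have "(\<lambda>x. if x \<in> {0<..<L} then a x else 0) \<in> borel_measurable lebesgue"
      by (rule borel_measurable_if_I[OF a_meas]) simp
    then have [measurable]: "(\<lambda>x. if x \<in> {0<..<L} then a x else 0) \<in> borel_measurable (lebesgue_on {0..L})"
      by (rule measurable_restrict_space1)
    have [measurable]: "indicat_real {0} \<in> borel_measurable (lebesgue_on {0..L})"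
      "indicat_real {L} \<in> borel_measurable (lebesgue_on {0..L})"
      by (rule indicator_measurable_lebesgue_on, simp)+
    \<comment> \<open>The density is given on the open interval, so its values at the end points are split off.\<close>
    have "a \<in> borel_measurable (lebesgue_on {0..L}) \<longleftrightarrow>
      (\<lambda>x. (if x \<in> {0<..<L} then a x else 0) + a 0 * indicat_real {0} x + a L * indicat_real {L} x)
        \<in> borel_measurable (lebesgue_on {0..L})"
      by (rule measurable_cong) (use L in \<open>auto simp: indicator_def\<close>)
    also have "\<dots>" by measurable
    finally show ?thesis .
  qed
  have b_eq_a: "AE x in lebesgue_on {0..L}. b x = a x"
  proof -
    have "AE x in lebesgue. x \<in> {0<..<L} \<longrightarrow> \<bar>a x\<bar> \<le> C"
      using C by (subst (asm) AE_restrict_space_iff) auto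
    moreover have "AE x in lebesgue. x \<notin> {0, L}"
      by (rule AE_not_in) simp
    ultimately have "AE x in lebesgue. x \<in> {0..L} \<longrightarrow> b x = a x"
      by eventually_elim (auto simp: b_def)
    then show ?thesis by (subst AE_restrict_space_iff) auto
  qed
  have b_bound: "\<bar>b x\<bar> \<le> max C 0" for x by (auto simp: b_def)
  have b_int: "b integrable_on {p..q}" for p q
  proof -
    have "b absolutely_integrable_on {p..q}"
      by (rule measurable_bounded_by_integrable_imp_absolutely_integrable[OF b_meas,
          where g = "\<lambda>_. max C 0"]) (use b_bound in auto)
    then show ?thesis by (simp add: absolutely_integrable_on_def)
  qed
  define F where "F x = integral {0..x} b" for x
  have F_cont: "continuous_on {0..L} F"
    unfolding F_def by (rule indefinite_integral_continuous_1[OF b_int])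
  have A_F: "A x = F x + (\<Sum>p\<in>Q. c p * heaviside (x - p))" if x: "x \<in> {0..L}" for x
  proof -
    have "(LINT s|lebesgue_on {0..x}. a s) = (LINT s|lebesgue_on {0..x}. b s)"
    proof (rule integral_cong_AE)
      show "a \<in> borel_measurable (lebesgue_on {0..x})"
        by (rule measurable_restrict_mono[OF a_meas']) (use x in auto)
      have "AE s in lebesgue_on {0..x}. b s = a s"
        by (rule AE_lebesgue_on_subset[OF b_eq_a]) (use x in auto)
      then show "AE s in lebesgue_on {0..x}. a s = b s" by eventually_elim simp
    qed (rule b_meas)
    also have "\<dots> = F x"
      unfolding F_def
    proof (rule lebesgue_integral_eq_integral)
      have "b absolutely_integrable_on {0..x}"
        by (rule measurable_bounded_by_integrable_imp_absolutely_integrable[OF b_meas,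
          where g = "\<lambda>_. max C 0"]) (use b_bound in auto)
      then show "integrable (lebesgue_on {0..x}) b"
        by (rule absolutely_integrable_imp_integrable) simp
    qed simp
    finally show ?thesis using A[OF x] by simp
  qed
  have c_zero: "c p = 0" if p: "p \<in> Q" "p \<notin> t ` {1..<n}" for p
  proof (rule step_coefficient_zero_if_continuous[OF A_F F_cont Q(1) p(1)])
    show p_bounds: "0 < p" "p < L" using p Q by auto
    have "p \<notin> discontinuities L A" using disc p(2) by blast
    then show "continuous (at p within {0..L}) A"
      using p_bounds by (simp add: discontinuities_def)
  qed
  have t_0: "t 0 = 0" and t_n: "t n = L" and n_pos: "n \<ge> 1"
    using partition by (auto simp: is_partition_def)
  note t_mono = partition_mono[OF partition]
  have increment: "A x = A (t (k - 1)) + integral {t (k - 1)..x} b"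
    if k: "k \<in> {1..n}" and x: "t (k - 1) \<le> x" "x \<le> L" and no: "\<And>j. j \<in> {1..<n} \<Longrightarrow> k \<le> j \<Longrightarrow> x < t j" for k x
  proof -
    have tk: "0 \<le> t (k - 1)" using t_mono[of 0 "k - 1"] k t_0 by auto
    have "c p * heaviside (x - p) = c p * heaviside (t (k - 1) - p)" if p: "p \<in> Q" for p
    proof (cases "c p = 0")
      case False
      then obtain j where j: "j \<in> {1..<n}" "p = t j" using c_zero[OF p] by blast
      show ?thesis
      proof (cases "k \<le> j")
        case True
        then show ?thesis using no[OF j(1)] j x by (simp add: heaviside_def)
      next
        case False
        then have "t j \<le> t (k - 1)" using k by (intro t_mono) auto
        then show ?thesis using j x by (simp add: heaviside_def)
      qed
    qed simp
    then have "(\<Sum>p\<in>Q. c p * heaviside (x - p)) = (\<Sum>p\<in>Q. c p * heaviside (t (k - 1) - p))"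
      by (rule sum.cong[OF refl])
    moreover have "F x - F (t (k - 1)) = integral {t (k - 1)..x} b"
      unfolding F_def by (rule integral_Icc_diff[OF b_int tk x(1) order_refl])
    ultimately show ?thesis
      using A_F[of x] A_F[of "t (k - 1)"] tk x by simp
  qed
  have "piecewise_phase L A a b (max C 0) n t"
  proof
    show "A 0 = 0" using nice by (simp add: nice_def admissible_def)
    show "A \<in> borel_measurable (lebesgue_on {0..L})"
    proof -
      have [measurable]: "F \<in> borel_measurable (lebesgue_on {0..L})"
        by (rule continuous_imp_measurable_on_sets_lebesgue[OF F_cont]) simp
      have [measurable]: "(\<lambda>x. heaviside (x - p)) \<in> borel_measurable (lebesgue_on {0..L})" for p
      proof -
        have "(\<lambda>x. heaviside (x - p)) = indicat_real {p..}"
          by (auto simp: heaviside_def indicator_def)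
        then show ?thesis
          by (simp add: indicator_measurable_lebesgue_on)
      qed
      have "A \<in> borel_measurable (lebesgue_on {0..L}) \<longleftrightarrow>
        (\<lambda>x. F x + (\<Sum>p\<in>Q. c p * heaviside (x - p))) \<in> borel_measurable (lebesgue_on {0..L})"
        by (rule measurable_cong) (use A_F in auto)
      also have "\<dots>" by measurable
      finally show ?thesis .
    qed
    show "A x = A (t (k - 1)) + integral {t (k - 1)..x} b"
      if k: "k \<in> {1..n}" and x: "t (k - 1) \<le> x" "x < t k" for k x
    proof (rule increment[OF k x(1)])
      show "x \<le> L" using t_mono[of k n] k x t_n by auto
      show "x < t j" if "j \<in> {1..<n}" "k \<le> j" for j
        using t_mono[of k j] that x by auto
    qed
    show "A L = A (t (n - 1)) + integral {t (n - 1)..L} b"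
      by (rule increment) (use n_pos t_mono[of "n - 1" n] t_n in auto)
  qed (use L partition a_meas' b_meas b_eq_a b_bound in auto)
  then show ?thesis using that by blast
qed

theorem theorem1p8:
  fixes L :: real and A a :: "real \<Rightarrow> real" and n :: nat and t :: "nat \<Rightarrow> real"
  assumes "L > 0"
    and "nice L A"
    and "nice_density L A a"
    and "is_partition L n t"
    and "discontinuities L A \<subseteq> t ` {1..<n}"
  shows "L_op n t A a =
    total_op (L2 {0..L}) (IP n t) \<circ>\<^sub>m T_op L A \<circ>\<^sub>m inverse_op (L2 {0..L}) (IP n t)"
proof -
  obtain b C where "piecewise_phase L A a b C n t"
    using nice_imp_piecewise_phase[OF assms] .
  then show ?thesis by (rule piecewise_phase.L_op_eq_conjugated_T_op)
qed

end
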